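(* Let $X=\ell_p$ (complex sequences indexed by $\mathbb Z_+$) with $1<p<\infty$. Then a typical $T\in(\mathcal B_1(X),\mathrm{SOT})$ admits a non-trivial invariant closed convex cone and (hence) a non-zero non-supercyclic vector.
   Context: $\mathcal B_1(X)$ is the set of all bounded linear operators $T$ on $X$ with $\|T\|\le 1$. SOT (Strong Operator Topology) is the topology of pointwise norm convergence on $X$; $(\mathcal B_1(X),\mathrm{SOT})$ is a Polish space. "A typical $T\in(\mathcal B_1(X),\mathrm{SOT})$ satisfies (P)" means that the set of $T\in\mathcal B_1(X)$ satisfying (P) is comeager in $(\mathcal B_1(X),\mathrm{SOT})$. A non-trivial invariant closed convex cone for $T$ is a closed convex set $C\subseteq X$ with $tC\subseteq C$ for all $t\ge0$, $C\ne\{0\}$, $C\ne\emptyset$, $C\neq X$, and $T(C)\subseteq C$. A vector $x\in X$ is supercyclic for $T$ if $\{\lambda T^nx:\ n\ge0,\ \lambda\in\mathbb C\}$ is dense in $X$, and non-supercyclic otherwise. *)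

theory Defs
  imports "HOL-Analysis.Analysis"
begin

section \<open>Baire category in an abstract topological space\<close>

definition nowhere_dense_in :: "'a topology \<Rightarrow> 'a set \<Rightarrow> bool" where
  "nowhere_dense_in X A \<longleftrightarrow> A \<subseteq> topspace X \<and> X interior_of (X closure_of A) = {}"

definition meager_in :: "'a topology \<Rightarrow> 'a set \<Rightarrow> bool" where
  "meager_in X A \<longleftrightarrow> (\<exists>\<F>. countable \<F> \<and> (\<forall>N\<in>\<F>. nowhere_dense_in X N) \<and> A = \<Union>\<F>)"

definition comeager_in :: "'a topology \<Rightarrow> 'a set \<Rightarrow> bool" where
  "comeager_in X A \<longleftrightarrow> A \<subseteq> topspace X \<and> meager_in X (topspace X - A)"


section \<open>The complex sequence space of exponent \<open>p\<close>\<close>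

text \<open>The exponent is a real number, so the space is a carrier set inside
  \<^typ>\<open>nat \<Rightarrow> complex\<close>, with pointwise vector space operations, rather than a type.\<close>

definition lp_space :: "real \<Rightarrow> (nat \<Rightarrow> complex) set" where
  "lp_space p = {x. summable (\<lambda>n. norm (x n) powr p)}"

definition lp_norm :: "real \<Rightarrow> (nat \<Rightarrow> complex) \<Rightarrow> real" where
  "lp_norm p x = (\<Sum>n. norm (x n) powr p) powr (1 / p)"

definition lp_dist :: "real \<Rightarrow> (nat \<Rightarrow> complex) \<Rightarrow> (nat \<Rightarrow> complex) \<Rightarrow> real" where
  "lp_dist p x y = lp_norm p (\<lambda>n. x n - y n)"

definition lp_topology :: "real \<Rightarrow> (nat \<Rightarrow> complex) topology" where
  "lp_topology p = Metric_space.mtopology (lp_space p) (lp_dist p)"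

lemma powr_add_convex_bound:
  fixes a b :: real
  assumes "1 \<le> p" "0 \<le> a" "0 \<le> b" "0 < t" "t < 1"
  shows "(t * a + (1 - t) * b) powr p \<le> t * a powr p + (1 - t) * b powr p"
proof -
  have scale: "(s * c) powr p \<le> s * c powr p" if "0 < s" "s < 1" "0 \<le> c" for s c :: real
  proof -
    have "s powr p \<le> s powr 1"
      using that assms(1) by (intro powr_mono') auto
    then show ?thesis
      using that by (simp add: powr_mult mult_right_mono)
  qed
  consider "a = 0" | "b = 0" | "0 < a" "0 < b"
    using assms by linarith
  then show ?thesis
  proof cases
    case 1
    then show ?thesis using scale[of "1 - t" b] assms by simp
  next
    case 2
    then show ?thesis using scale[of t a] assms by simp
  next
    case 3
    then show ?thesis
      using convex_onD[OF powr_convex[OF assms(1)], of "1 - t" a b] assms by simp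
  qed
qed

lemma lp_norm_nonneg: "0 \<le> lp_norm p x"
  by (simp add: lp_norm_def)

lemma lp_norm_powr:
  assumes "1 \<le> p" "x \<in> lp_space p"
  shows "lp_norm p x powr p = (\<Sum>n. norm (x n) powr p)"
  using assms by (simp add: lp_norm_def lp_space_def powr_powr suminf_nonneg)

lemma lp_norm_eq_0:
  assumes "1 \<le> p" "x \<in> lp_space p"
  shows "lp_norm p x = 0 \<longleftrightarrow> x = (\<lambda>_. 0)"
  using assms by (auto simp: lp_norm_def lp_space_def suminf_eq_zero_iff)

lemma lp_space_zero: "(\<lambda>_. 0) \<in> lp_space p"
  by (simp add: lp_space_def)

lemma lp_scale_aux: "norm (c * x n) powr p = norm c powr p * norm (x n) powr p"
  for c :: complex
  by (simp add: norm_mult powr_mult)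

lemma lp_space_scale: "x \<in> lp_space p \<Longrightarrow> (\<lambda>n. c * x n) \<in> lp_space p"
  by (simp add: lp_space_def lp_scale_aux summable_mult)

lemma lp_norm_scale:
  assumes "1 \<le> p" "x \<in> lp_space p"
  shows "lp_norm p (\<lambda>n. c * x n) = norm c * lp_norm p x"
  using assms
  by (simp add: lp_norm_def lp_space_def lp_scale_aux suminf_mult powr_mult suminf_nonneg powr_powr)

lemma lp_add_bound:
  fixes u v :: complex
  assumes "1 \<le> p" "0 < a" "0 < b"
  shows "norm (u + v) powr p \<le> (a + b) powr p *
    (a / (a + b) * (norm u powr p / a powr p) + b / (a + b) * (norm v powr p / b powr p))"
proof -
  define t where "t = a / (a + b)"
  have t: "0 < t" "t < 1" and t': "1 - t = b / (a + b)"
    using assms by (auto simp: t_def field_simps)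
  have eq: "norm u + norm v = (a + b) * (t * (norm u / a) + (1 - t) * (norm v / b))"
    unfolding t' unfolding t_def using assms by (simp add: field_simps add_nonneg_eq_0_iff)
  have "norm (u + v) powr p \<le> (norm u + norm v) powr p"
    using assms by (intro powr_mono2) (auto simp: norm_triangle_ineq)
  also have "\<dots> = (a + b) powr p * (t * (norm u / a) + (1 - t) * (norm v / b)) powr p"
    unfolding eq using assms t by (subst powr_mult) auto
  also have "\<dots> \<le> (a + b) powr p * (t * (norm u / a) powr p + (1 - t) * (norm v / b) powr p)"
    using assms t by (intro mult_left_mono powr_add_convex_bound) auto
  finally show ?thesis
    unfolding t' using assms by (simp add: t_def powr_divide)
qed

lemma lp_space_add:
  assumes "1 \<le> p" "x \<in> lp_space p" "y \<in> lp_space p"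
  shows "(\<lambda>n. x n + y n) \<in> lp_space p"
proof -
  let ?g = "\<lambda>n. (1 + 1) powr p * (1 / (1 + 1) * (norm (x n) powr p / 1 powr p)
    + 1 / (1 + 1) * (norm (y n) powr p / 1 powr p))"
  have "summable ?g"
    using assms by (intro summable_mult summable_add summable_divide) (auto simp: lp_space_def)
  then have "summable (\<lambda>n. norm (x n + y n) powr p)"
    by (rule summable_comparison_test') (use lp_add_bound[OF assms(1), of 1 1] in auto)
  then show ?thesis
    by (simp add: lp_space_def)
qed

lemma lp_norm_triangle:
  assumes "1 \<le> p" "x \<in> lp_space p" "y \<in> lp_space p"
  shows "lp_norm p (\<lambda>n. x n + y n) \<le> lp_norm p x + lp_norm p y"
proof -
  define a b where "a = lp_norm p x" and "b = lp_norm p y"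
  consider "a = 0" | "b = 0" | "0 < a" "0 < b"
    using lp_norm_nonneg unfolding a_def b_def by (metis less_eq_real_def)
  then show ?thesis
  proof cases
    case 1
    then show ?thesis using assms lp_norm_eq_0 lp_norm_nonneg by (simp add: a_def)
  next
    case 2
    then show ?thesis using assms lp_norm_eq_0 lp_norm_nonneg by (simp add: b_def)
  next
    case 3
    let ?g = "\<lambda>n. (a + b) powr p *
      (a / (a + b) * (norm (x n) powr p / a powr p) + b / (a + b) * (norm (y n) powr p / b powr p))"
    have sx: "(\<lambda>n. norm (x n) powr p) sums (a powr p)"
      and sy: "(\<lambda>n. norm (y n) powr p) sums (b powr p)"
      using assms lp_norm_powr by (auto simp: a_def b_def lp_space_def summable_sums)
    have g: "?g sums ((a + b) powr p *
      (a / (a + b) * (a powr p / a powr p) + b / (a + b) * (b powr p / b powr p)))"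
      by (intro sums_mult sums_add sums_divide sx sy)
    have "(a + b) powr p * (a / (a + b) * (a powr p / a powr p) + b / (a + b) * (b powr p / b powr p))
        = (a + b) powr p"
      using 3 by (simp flip: add_divide_distrib)
    then have g: "?g sums ((a + b) powr p)"
      using g by (simp only:)
    have "summable (\<lambda>n. norm (x n + y n) powr p)"
      using lp_space_add[OF assms] by (simp add: lp_space_def)
    then have "(\<Sum>n. norm (x n + y n) powr p) \<le> (a + b) powr p"
      using sums_unique[OF g] sums_summable[OF g] lp_add_bound[OF assms(1) 3]
      by (metis (no_types, lifting) suminf_le)
    then have "lp_norm p (\<lambda>n. x n + y n) powr p \<le> (a + b) powr p"
      using lp_norm_powr[OF assms(1) lp_space_add[OF assms]] by simp
    then show ?thesis
      using 3 assms(1) lp_norm_nonneg powr_less_mono2[of p "a + b" "lp_norm p (\<lambda>n. x n + y n)"]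
      unfolding a_def b_def by (meson add_nonneg_nonneg le_less_trans less_le_not_le linorder_not_le zero_less_one order_less_le_trans)
  qed
qed

lemma lp_space_diff:
  assumes "1 \<le> p" "x \<in> lp_space p" "y \<in> lp_space p"
  shows "(\<lambda>n. x n - y n) \<in> lp_space p"
  using lp_space_add[OF assms(1,2) lp_space_scale[OF assms(3), of "-1"]] by simp

lemma lp_Metric_space:
  assumes "1 \<le> p"
  shows "Metric_space (lp_space p) (lp_dist p)"
proof
  show "0 \<le> lp_dist p x y" for x y
    by (simp add: lp_dist_def lp_norm_nonneg)
  show "lp_dist p x y = lp_dist p y x" for x y
    by (simp add: lp_dist_def lp_norm_def norm_minus_commute)
  show "lp_dist p x y = 0 \<longleftrightarrow> x = y" if "x \<in> lp_space p" "y \<in> lp_space p" for x y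
    using lp_norm_eq_0[OF assms lp_space_diff[OF assms that]] by (auto simp: lp_dist_def fun_eq_iff)
  show "lp_dist p x z \<le> lp_dist p x y + lp_dist p y z"
    if "x \<in> lp_space p" "y \<in> lp_space p" "z \<in> lp_space p" for x y z
    using lp_norm_triangle[OF assms lp_space_diff[OF assms that(1,2)] lp_space_diff[OF assms that(2,3)]]
    by (simp add: lp_dist_def)
qed

lemma topspace_lp_topology: "1 \<le> p \<Longrightarrow> topspace (lp_topology p) = lp_space p"
  by (simp add: lp_topology_def Metric_space.topspace_mtopology lp_Metric_space)


section \<open>Operators and the strong operator topology\<close>

text \<open>Operators are extensional (equal to \<^const>\<open>undefined\<close> off the carrier), so that
  equality of functions is equality of operators.\<close>

definition lp_operator :: "real \<Rightarrow> ((nat \<Rightarrow> complex) \<Rightarrow> (nat \<Rightarrow> complex)) \<Rightarrow> bool" where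
  "lp_operator p T \<longleftrightarrow>
     T \<in> lp_space p \<rightarrow>\<^sub>E lp_space p \<and>
     (\<forall>x\<in>lp_space p. \<forall>y\<in>lp_space p. T (\<lambda>n. x n + y n) = (\<lambda>n. T x n + T y n)) \<and>
     (\<forall>c. \<forall>x\<in>lp_space p. T (\<lambda>n. c * x n) = (\<lambda>n. c * T x n)) \<and>
     (\<exists>K. \<forall>x\<in>lp_space p. lp_norm p (T x) \<le> K * lp_norm p x)"

text \<open>The analogue of \<^const>\<open>onorm\<close>; the quotient is \<open>0\<close> at the zero vector.\<close>

definition lp_onorm :: "real \<Rightarrow> ((nat \<Rightarrow> complex) \<Rightarrow> (nat \<Rightarrow> complex)) \<Rightarrow> real" where
  "lp_onorm p T = (SUP x\<in>lp_space p. lp_norm p (T x) / lp_norm p x)"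

definition lp_contractions :: "real \<Rightarrow> ((nat \<Rightarrow> complex) \<Rightarrow> (nat \<Rightarrow> complex)) set" where
  "lp_contractions p = {T. lp_operator p T \<and> lp_onorm p T \<le> 1}"

text \<open>Pointwise norm convergence is the product topology over the points of the space.\<close>

definition lp_SOT :: "real \<Rightarrow> ((nat \<Rightarrow> complex) \<Rightarrow> (nat \<Rightarrow> complex)) topology" where
  "lp_SOT p =
     subtopology (product_topology (\<lambda>_. lp_topology p) (lp_space p)) (lp_contractions p)"

lemma topspace_lp_SOT: "1 \<le> p \<Longrightarrow> topspace (lp_SOT p) = lp_contractions p"
  by (auto simp: lp_SOT_def topspace_lp_topology lp_contractions_def lp_operator_def)

lemma lp_contractions_iff:
  assumes "1 \<le> p"
  shows "T \<in> lp_contractions p \<longleftrightarrow>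
    lp_operator p T \<and> (\<forall>x\<in>lp_space p. lp_norm p (T x) \<le> lp_norm p x)"
proof (intro iffI conjI ballI)
  assume T: "T \<in> lp_contractions p"
  then show op: "lp_operator p T"
    by (simp add: lp_contractions_def)
  then obtain K where K: "\<And>x. x \<in> lp_space p \<Longrightarrow> lp_norm p (T x) \<le> K * lp_norm p x"
    unfolding lp_operator_def by blast
  fix x assume x: "x \<in> lp_space p"
  have "bdd_above ((\<lambda>x. lp_norm p (T x) / lp_norm p x) ` lp_space p)"
  proof (rule bdd_aboveI2)
    fix y assume y: "y \<in> lp_space p"
    show "lp_norm p (T y) / lp_norm p y \<le> \<bar>K\<bar>"
    proof (cases "lp_norm p y = 0")
      case False
      then have "0 < lp_norm p y"
        using lp_norm_nonneg[of p y] by simp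
      then have "lp_norm p (T y) / lp_norm p y \<le> K"
        using K[OF y] by (simp add: divide_le_eq)
      then show ?thesis by simp
    qed simp
  qed
  then have "lp_norm p (T x) / lp_norm p x \<le> lp_onorm p T"
    unfolding lp_onorm_def by (rule cSUP_upper[OF x])
  then have le1: "lp_norm p (T x) / lp_norm p x \<le> 1"
    using T by (simp add: lp_contractions_def)
  show "lp_norm p (T x) \<le> lp_norm p x"
  proof (cases "lp_norm p x = 0")
    case True
    then show ?thesis using K[OF x] by simp
  next
    case False
    then show ?thesis
      using le1 lp_norm_nonneg[of p x] by (simp add: divide_le_eq_1)
  qed
next
  assume R: "lp_operator p T \<and> (\<forall>x\<in>lp_space p. lp_norm p (T x) \<le> lp_norm p x)"
  have "lp_onorm p T \<le> 1"
    unfolding lp_onorm_def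
  proof (rule cSUP_least)
    show "lp_space p \<noteq> {}" using lp_space_zero by blast
    show "lp_norm p (T x) / lp_norm p x \<le> 1" if "x \<in> lp_space p" for x
      using R that lp_norm_nonneg[of p x] by (auto simp: divide_le_eq_1)
  qed
  with R show "T \<in> lp_contractions p"
    by (simp add: lp_contractions_def)
qed

section \<open>Invariant cones and supercyclic vectors\<close>

definition nontrivial_invariant_closed_convex_cone ::
    "real \<Rightarrow> ((nat \<Rightarrow> complex) \<Rightarrow> (nat \<Rightarrow> complex)) \<Rightarrow> (nat \<Rightarrow> complex) set \<Rightarrow> bool" where
  "nontrivial_invariant_closed_convex_cone p T C \<longleftrightarrow>
     closedin (lp_topology p) C \<and>
     (\<forall>x\<in>C. \<forall>y\<in>C. \<forall>u\<ge>0. \<forall>v\<ge>0. u + v = 1 \<longrightarrow>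
        (\<lambda>n. complex_of_real u * x n + complex_of_real v * y n) \<in> C) \<and>
     (\<forall>t\<ge>0. (\<lambda>x n. complex_of_real t * x n) ` C \<subseteq> C) \<and>
     C \<noteq> {\<lambda>_. 0} \<and> C \<noteq> {} \<and> C \<noteq> lp_space p \<and>
     T ` C \<subseteq> C"

definition supercyclic_vector ::
    "real \<Rightarrow> ((nat \<Rightarrow> complex) \<Rightarrow> (nat \<Rightarrow> complex)) \<Rightarrow> (nat \<Rightarrow> complex) \<Rightarrow> bool" where
  "supercyclic_vector p T x \<longleftrightarrow>
     lp_topology p closure_of {\<lambda>n. c * (T ^^ k) x n | c k. True} = lp_space p"

end

theory Submission
  imports Defs
begin

text \<open>Two properties are generic. First, \<open>T\<^sup>n e\<^sub>m \<rightarrow> 0\<close> for every unit vector (approximate by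
  \<open>s T\<close> with \<open>s < 1\<close>). Second, for every \<open>r < 1\<close> of the form \<open>1 - 1 / (k + 2)\<close> there are unit vectors
  arbitrarily far out that are almost eigenvectors for \<open>r\<close> (compress \<open>T\<close> to the first \<open>M\<close> coordinates
  and add \<open>r\<close> on the \<open>M\<close>-th one). Given such a \<open>T\<close>, choose \<open>m\<^sub>0 < m\<^sub>1 < \<dots>\<close> and \<open>r\<^sub>k\<close> inductively, each
  \<open>r\<^sub>k\<close> so close to \<open>1\<close> that \<open>r\<^sub>k\<^sup>n\<close> is still at least \<open>1/2\<close> at the time when the orbits of all the earlier
  unit vectors have become negligible. For \<open>x = \<Sum> 2\<^sup>-\<^sup>k e\<close>, summed over \<open>e = e\<^bsub>m\<^sub>k\<^esub>\<close>, and a functional \<open>f\<close>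
  with comparable positive weights on the same coordinates, all \<open>f (T\<^sup>n x)\<close> then lie in a narrow sector
  around the positive axis. So \<open>{y. \<forall>n. Re f (T\<^sup>n y) \<ge> 0}\<close> is an invariant cone. For two linearly
  independent such functionals \<open>f\<close> and \<open>g\<close>, the inequality \<open>Re (f z \<cdot> cnj (g z)) \<ge> 0\<close> persists on the
  closure of all complex multiples of the orbit, hence \<open>x\<close> is not supercyclic.\<close>

subsection \<open>Norm estimates in the sequence space\<close>

definition lp_unit :: "nat \<Rightarrow> nat \<Rightarrow> complex" where
  "lp_unit m = (\<lambda>i. if i = m then 1 else 0)"

definition lp_trunc :: "nat \<Rightarrow> (nat \<Rightarrow> complex) \<Rightarrow> nat \<Rightarrow> complex" where
  "lp_trunc N x = (\<lambda>i. if i < N then x i else 0)"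

lemma lp_space_domI:
  assumes "1 \<le> p" "y \<in> lp_space p" "\<And>i. norm (x i) \<le> norm (y i)"
  shows "x \<in> lp_space p"
proof -
  have "summable (\<lambda>i. norm (x i) powr p)"
    by (rule summable_comparison_test'[of "\<lambda>i. norm (y i) powr p" 0])
       (use assms in \<open>auto simp: lp_space_def intro!: powr_mono2\<close>)
  then show ?thesis by (simp add: lp_space_def)
qed

lemma lp_norm_leI:
  assumes "1 \<le> p" "x \<in> lp_space p" "y \<in> lp_space p"
    "(\<Sum>i. norm (x i) powr p) \<le> (\<Sum>i. norm (y i) powr p)"
  shows "lp_norm p x \<le> lp_norm p y"
  unfolding lp_norm_def using assms
  by (intro powr_mono2) (auto simp: lp_space_def intro!: suminf_nonneg)

lemma lp_norm_mono:
  assumes "1 \<le> p" "y \<in> lp_space p" "\<And>i. norm (x i) \<le> norm (y i)"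
  shows "lp_norm p x \<le> lp_norm p y"
proof (rule lp_norm_leI[OF assms(1) lp_space_domI[OF assms] assms(2)])
  show "(\<Sum>i. norm (x i) powr p) \<le> (\<Sum>i. norm (y i) powr p)"
    using lp_space_domI[OF assms] assms
    by (intro suminf_le powr_mono2) (auto simp: lp_space_def)
qed

lemma lp_unit_in: "1 \<le> p \<Longrightarrow> lp_unit m \<in> lp_space p"
  unfolding lp_space_def lp_unit_def
  by (auto intro!: summable_finite[of "{m}"] split: if_splits)

lemma lp_norm_unit: "1 \<le> p \<Longrightarrow> lp_norm p (lp_unit m) = 1"
proof -
  assume "1 \<le> p"
  have "(\<Sum>i. norm (lp_unit m i) powr p) = (\<Sum>i\<in>{m}. norm (lp_unit m i) powr p)"
    by (rule suminf_finite) (auto simp: lp_unit_def)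
  then show ?thesis by (simp add: lp_norm_def lp_unit_def)
qed

lemma lp_norm_scale_unit: "1 \<le> p \<Longrightarrow> lp_norm p (\<lambda>i. c * lp_unit m i) = norm c"
  by (simp add: lp_norm_scale lp_unit_in lp_norm_unit)

lemma lp_coord_le:
  assumes "1 \<le> p" "x \<in> lp_space p"
  shows "norm (x m) \<le> lp_norm p x"
proof -
  have "lp_norm p (\<lambda>i. x m * lp_unit m i) \<le> lp_norm p x"
    by (rule lp_norm_mono) (use assms in \<open>auto simp: lp_unit_def\<close>)
  then show ?thesis by (simp add: lp_norm_scale_unit assms)
qed

lemma lp_trunc_in: "1 \<le> p \<Longrightarrow> x \<in> lp_space p \<Longrightarrow> lp_trunc N x \<in> lp_space p"
  by (rule lp_space_domI[of p x]) (auto simp: lp_trunc_def)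

lemma lp_norm_trunc_le: "1 \<le> p \<Longrightarrow> x \<in> lp_space p \<Longrightarrow> lp_norm p (lp_trunc N x) \<le> lp_norm p x"
  by (rule lp_norm_mono) (auto simp: lp_trunc_def)

lemma lp_norm_minus_commute: "lp_norm p (\<lambda>i. x i - y i) = lp_norm p (\<lambda>i. y i - x i)"
  by (simp add: lp_norm_def norm_minus_commute)

lemma lp_norm_zero: "1 \<le> p \<Longrightarrow> lp_norm p (\<lambda>_. 0) = 0"
  by (simp add: lp_norm_def)

lemma lp_trunc_tendsto:
  assumes "1 \<le> p" "x \<in> lp_space p"
  shows "(\<lambda>N. lp_norm p (\<lambda>i. x i - lp_trunc N x i)) \<longlonglongrightarrow> 0"
proof -
  let ?f = "\<lambda>i. norm (x i) powr p"
  have sm: "summable ?f" using assms by (simp add: lp_space_def)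
  have eq: "(\<Sum>i. norm (x i - lp_trunc N x i) powr p) = suminf ?f - sum ?f {..<N}" for N
  proof -
    have "(\<lambda>i. ?f i - (if i < N then ?f i else 0)) sums (suminf ?f - sum ?f {..<N})"
      using sums_If_finite_set[of "{..<N}" ?f] 
      by (intro sums_diff summable_sums sm) auto
    moreover have "(\<lambda>i. ?f i - (if i < N then ?f i else 0)) = (\<lambda>i. norm (x i - lp_trunc N x i) powr p)"
      by (auto simp: lp_trunc_def)
    ultimately show ?thesis by (simp only: sums_iff)
  qed
  have nn: "0 \<le> suminf ?f - sum ?f {..<N}" for N
    using sum_le_suminf[OF sm, of "{..<N}"] by simp
  have "(\<lambda>N. suminf ?f - sum ?f {..<N}) \<longlonglongrightarrow> suminf ?f - suminf ?f"
    by (intro tendsto_intros summable_LIMSEQ sm)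
  then have "(\<lambda>N. (suminf ?f - sum ?f {..<N}) powr (1 / p)) \<longlonglongrightarrow> 0 powr (1 / p)"
    by (intro tendsto_powr') (use nn assms in auto)
  then show ?thesis
    by (simp add: lp_norm_def eq)
qed

subsection \<open>Bounded linear functionals and non-expansive linear maps\<close>

text \<open>\<open>B\<close> is any admissible bound rather than the operator norm, so it passes
  unchanged to \<open>f\<close> composed with a non-expansive map.\<close>

definition lp_functional :: "real \<Rightarrow> real \<Rightarrow> ((nat \<Rightarrow> complex) \<Rightarrow> complex) \<Rightarrow> bool" where
  "lp_functional p B f \<longleftrightarrow>
     (\<forall>x\<in>lp_space p. \<forall>y\<in>lp_space p. f (\<lambda>n. x n + y n) = f x + f y) \<and>
     (\<forall>c. \<forall>x\<in>lp_space p. f (\<lambda>n. c * x n) = c * f x) \<and>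
     (\<forall>x\<in>lp_space p. norm (f x) \<le> B * lp_norm p x)"

text \<open>These are the contractions without extensionality. Powers have to stay in the class, and
  already \<open>T ^^ 0\<close> is the identity on all sequences, which is not extensional.\<close>

definition lp_nonexpansive :: "real \<Rightarrow> ((nat \<Rightarrow> complex) \<Rightarrow> nat \<Rightarrow> complex) \<Rightarrow> bool" where
  "lp_nonexpansive p T \<longleftrightarrow>
     (\<forall>x\<in>lp_space p. T x \<in> lp_space p) \<and>
     (\<forall>x\<in>lp_space p. \<forall>y\<in>lp_space p. T (\<lambda>n. x n + y n) = (\<lambda>n. T x n + T y n)) \<and>
     (\<forall>c. \<forall>x\<in>lp_space p. T (\<lambda>n. c * x n) = (\<lambda>n. c * T x n)) \<and>
     (\<forall>x\<in>lp_space p. lp_norm p (T x) \<le> lp_norm p x)"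

lemma lp_contractions_nonexpansive:
  "1 \<le> p \<Longrightarrow> T \<in> lp_contractions p \<Longrightarrow> lp_nonexpansive p T"
  by (auto simp: lp_contractions_iff lp_operator_def lp_nonexpansive_def)

lemma restrict_in_lp_contractions:
  assumes "1 \<le> p" "lp_nonexpansive p T"
  shows "restrict T (lp_space p) \<in> lp_contractions p"
  using assms unfolding lp_contractions_iff[OF assms(1)] lp_operator_def lp_nonexpansive_def
  by (auto simp: lp_space_add lp_space_scale intro!: exI[of _ 1])

lemma lp_nonexpansive_diff:
  assumes "1 \<le> p" "lp_nonexpansive p T" "x \<in> lp_space p" "y \<in> lp_space p"
  shows "T (\<lambda>n. x n - y n) = (\<lambda>n. T x n - T y n)"
proof -
  have "T (\<lambda>n. x n + (-1) * y n) = (\<lambda>n. T x n + (-1) * T y n)"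
    using assms lp_space_scale[OF assms(4), of "-1"] unfolding lp_nonexpansive_def by metis
  then show ?thesis by simp
qed

lemma lp_nonexpansive_funpow: "lp_nonexpansive p T \<Longrightarrow> lp_nonexpansive p (T ^^ n)"
proof (induction n)
  case (Suc n)
  then show ?case
    unfolding lp_nonexpansive_def by simp (meson order_trans)
qed (simp add: lp_nonexpansive_def)

lemma lp_functional_diff:
  assumes "1 \<le> p" "lp_functional p B f" "x \<in> lp_space p" "y \<in> lp_space p"
  shows "f (\<lambda>n. x n - y n) = f x - f y"
proof -
  have "f (\<lambda>n. x n + (-1) * y n) = f x + (-1) * f y"
    using assms lp_space_scale[OF assms(4), of "-1"] unfolding lp_functional_def by metis
  then show ?thesis by simp
qed

lemma lp_functional_comp:
  assumes "lp_functional p B f" "lp_nonexpansive p T" "0 \<le> B"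
  shows "lp_functional p B (\<lambda>x. f (T x))"
proof -
  have "norm (f (T x)) \<le> B * lp_norm p x" if "x \<in> lp_space p" for x
  proof -
    have "norm (f (T x)) \<le> B * lp_norm p (T x)"
      using assms that by (auto simp: lp_functional_def lp_nonexpansive_def)
    also have "\<dots> \<le> B * lp_norm p x"
      using assms that by (intro mult_left_mono) (auto simp: lp_nonexpansive_def)
    finally show ?thesis .
  qed
  then show ?thesis
    using assms by (auto simp: lp_functional_def lp_nonexpansive_def)
qed

lemma lp_functional_continuous:
  assumes "1 \<le> p" "lp_functional p B f" "0 \<le> B"
  shows "continuous_map (lp_topology p) euclidean f"
proof -
  interpret Metric_space "lp_space p" "lp_dist p" using assms(1) by (rule lp_Metric_space)
  show ?thesis
    unfolding lp_topology_def continuous_map_from_metric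
  proof (intro conjI ballI allI impI)
    fix a U assume a: "a \<in> lp_space p" and U: "openin euclidean U \<and> f a \<in> U"
    then obtain e where e: "e > 0" "\<And>z. dist z (f a) < e \<Longrightarrow> z \<in> U"
      using open_dist by (metis open_openin)
    show "\<exists>r>0. \<forall>x. x \<in> lp_space p \<and> lp_dist p a x < r \<longrightarrow> f x \<in> U"
    proof (intro exI conjI allI impI)
      \<comment> \<open>The denominator is \<open>B + 1\<close> because \<open>B\<close> may be
        0.\<close>
      show "0 < e / (B + 1)" using e assms by simp
      fix x assume x: "x \<in> lp_space p \<and> lp_dist p a x < e / (B + 1)"
      have "dist (f x) (f a) = norm (f (\<lambda>n. x n - a n))"
        using lp_functional_diff[OF assms(1,2)] x a by (simp add: dist_norm)
      also have "\<dots> \<le> B * lp_norm p (\<lambda>n. x n - a n)"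
        using assms lp_space_diff x a by (simp add: lp_functional_def)
      also have "\<dots> = B * lp_dist p a x"
        unfolding lp_dist_def by (subst lp_norm_minus_commute) simp
      also have "\<dots> \<le> (B + 1) * lp_dist p a x"
        using nonneg by (intro mult_right_mono) auto
      also have "\<dots> < e"
        using x assms by (simp add: pos_less_divide_eq mult.commute)
      finally show "f x \<in> U" using e by blast
    qed
  qed auto
qed

lemma lp_functional_trunc:
  assumes "1 \<le> p" "lp_functional p B f" "x \<in> lp_space p"
  shows "f (lp_trunc N x) = (\<Sum>i<N. x i * f (lp_unit i))"
proof (induction N)
  case 0
  have "f (\<lambda>n. 0 * x n) = 0 * f x" using assms unfolding lp_functional_def by blast
  then show ?case by (simp add: lp_trunc_def)
next
  case (Suc N)
  have "lp_trunc (Suc N) x = (\<lambda>n. lp_trunc N x n + x N * lp_unit N n)"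
    by (auto simp: fun_eq_iff lp_trunc_def lp_unit_def less_Suc_eq)
  then have "f (lp_trunc (Suc N) x) = f (lp_trunc N x) + x N * f (lp_unit N)"
    using assms lp_trunc_in lp_space_scale lp_unit_in unfolding lp_functional_def by simp
  then show ?case using Suc by simp
qed

text \<open>Truncations converge to \<open>x\<close> in norm and \<open>f\<close> is bounded, so the
  finite sums of \<open>lp_functional_trunc\<close> converge to \<open>f x\<close>. Applied to
  \<open>f\<close> composed with a power of an operator, this evaluates an orbit one unit vector at
  a time.\<close>

lemma lp_functional_sums:
  assumes "1 \<le> p" "lp_functional p B f" "x \<in> lp_space p"
  shows "(\<lambda>i. x i * f (lp_unit i)) sums f x"
  unfolding sums_def
proof (rule LIM_zero_cancel, rule Lim_null_comparison)
  show "\<forall>\<^sub>F N in sequentially. norm ((\<Sum>i<N. x i * f (lp_unit i)) - f x)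
      \<le> B * lp_norm p (\<lambda>i. x i - lp_trunc N x i)"
  proof (rule always_eventually, rule allI)
    fix N
    have "norm ((\<Sum>i<N. x i * f (lp_unit i)) - f x) = norm (f x - f (lp_trunc N x))"
      using lp_functional_trunc[OF assms] by (simp add: norm_minus_commute)
    also have "\<dots> = norm (f (\<lambda>i. x i - lp_trunc N x i))"
      using lp_functional_diff[OF assms(1,2,3)] lp_trunc_in assms by simp
    also have "\<dots> \<le> B * lp_norm p (\<lambda>i. x i - lp_trunc N x i)"
      using assms lp_space_diff lp_trunc_in by (simp add: lp_functional_def)
    finally show "norm ((\<Sum>i<N. x i * f (lp_unit i)) - f x)
      \<le> B * lp_norm p (\<lambda>i. x i - lp_trunc N x i)" .
  qed
  show "(\<lambda>N. B * lp_norm p (\<lambda>i. x i - lp_trunc N x i)) \<longlonglongrightarrow> 0"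
    using tendsto_mult[OF tendsto_const lp_trunc_tendsto[OF assms(1,3)], of B] by simp
qed

section \<open>Functionals given by summable nonnegative weights\<close>

definition lp_weighted :: "(nat \<Rightarrow> real) \<Rightarrow> (nat \<Rightarrow> complex) \<Rightarrow> complex" where
  "lp_weighted b x = (\<Sum>i. complex_of_real (b i) * x i)"

text \<open>Each coordinate is at most the norm, so weights with a finite sum give a bounded
  functional without recourse to the dual exponent.\<close>

lemma lp_weighted_summable:
  assumes "1 \<le> p" "\<And>i. 0 \<le> b i" "summable b" "x \<in> lp_space p"
  shows "summable (\<lambda>i. norm (complex_of_real (b i) * x i))"
    and "(\<Sum>i. norm (complex_of_real (b i) * x i)) \<le> suminf b * lp_norm p x"
proof -
  have le: "norm (complex_of_real (b i) * x i) \<le> b i * lp_norm p x" for i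
    using lp_coord_le[OF assms(1,4)] assms(2) by (simp add: norm_mult mult_left_mono)
  have s: "summable (\<lambda>i. b i * lp_norm p x)" using assms by (intro summable_mult2)
  show sm: "summable (\<lambda>i. norm (complex_of_real (b i) * x i))"
    by (rule summable_comparison_test'[OF s, of 0]) (use le in auto)
  have "(\<Sum>i. norm (complex_of_real (b i) * x i)) \<le> (\<Sum>i. b i * lp_norm p x)"
    by (rule suminf_le[OF le sm s])
  also have "\<dots> = suminf b * lp_norm p x" using assms suminf_mult2 by metis
  finally show "(\<Sum>i. norm (complex_of_real (b i) * x i)) \<le> suminf b * lp_norm p x" .
qed

lemma lp_weighted_functional:
  assumes "1 \<le> p" "\<And>i. 0 \<le> b i" "summable b"
  shows "lp_functional p (suminf b) (lp_weighted b)"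
proof -
  have sm: "summable (\<lambda>i. complex_of_real (b i) * x i)" if "x \<in> lp_space p" for x
    using summable_norm_cancel[OF lp_weighted_summable(1)[OF assms that]] .
  show ?thesis
    unfolding lp_functional_def lp_weighted_def
  proof (intro conjI ballI allI)
    fix x y assume "x \<in> lp_space p" "y \<in> lp_space p"
    then show "(\<Sum>i. complex_of_real (b i) * (x i + y i)) =
        (\<Sum>i. complex_of_real (b i) * x i) + (\<Sum>i. complex_of_real (b i) * y i)"
      by (subst suminf_add) (auto simp: sm distrib_left)
  next
    fix c x assume "x \<in> lp_space p"
    then show "(\<Sum>i. complex_of_real (b i) * (c * x i)) = c * (\<Sum>i. complex_of_real (b i) * x i)"
      by (subst suminf_mult[symmetric]) (auto simp: sm mult.left_commute)
  next
    fix x assume x: "x \<in> lp_space p"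
    show "norm (\<Sum>i. complex_of_real (b i) * x i) \<le> suminf b * lp_norm p x"
      using summable_norm[OF lp_weighted_summable(1)[OF assms x]] lp_weighted_summable(2)[OF assms x]
      by linarith
  qed
qed

lemma lp_weighted_unit: "lp_weighted b (lp_unit m) = complex_of_real (b m)"
proof -
  have "lp_weighted b (lp_unit m) = (\<Sum>i\<in>{m}. complex_of_real (b i) * lp_unit m i)"
    unfolding lp_weighted_def by (rule suminf_finite) (auto simp: lp_unit_def)
  then show ?thesis by (simp add: lp_unit_def)
qed

subsection \<open>Two generic properties\<close>

lemma comeager_in_countable_Inter:
  assumes "countable I" "\<And>i. i \<in> I \<Longrightarrow> openin X (U i)"
    "\<And>i. i \<in> I \<Longrightarrow> X closure_of (U i) = topspace X"
    "topspace X \<inter> (\<Inter>i\<in>I. U i) \<subseteq> A" "A \<subseteq> topspace X"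
  shows "comeager_in X A"
proof -
  \<comment> \<open>\<open>meager_in\<close> asks for an exact union, so each closed set
    \<open>topspace X - U i\<close> is cut down to the complement of \<open>A\<close>. It stays
    nowhere dense, being contained in the complement of a dense open set.\<close>
  let ?N = "\<lambda>i. (topspace X - U i) \<inter> (topspace X - A)"
  have "nowhere_dense_in X (?N i)" if "i \<in> I" for i
  proof -
    have "X closure_of (?N i) \<subseteq> topspace X - U i"
      using assms(2)[OF that] by (intro closure_of_minimal) auto
    then have "X interior_of (X closure_of (?N i)) \<subseteq> X interior_of (topspace X - U i)"
      by (rule interior_of_mono)
    also have "\<dots> = {}"
      using assms(3)[OF that] by (simp add: interior_of_complement)
    finally show ?thesis
      by (auto simp: nowhere_dense_in_def)
  qed
  moreover have "topspace X - A = \<Union>(?N ` I)"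
    using assms(4) by auto
  ultimately show ?thesis
    using assms(1,5) unfolding comeager_in_def meager_in_def
    by (intro conjI exI[of _ "?N ` I"]) auto
qed

section \<open>Continuity and density in the strong operator topology\<close>

lemma lp_mball:
  assumes "1 \<le> p"
  shows "y \<in> Metric_space.mball (lp_space p) (lp_dist p) x \<epsilon> \<longleftrightarrow>
    x \<in> lp_space p \<and> y \<in> lp_space p \<and> lp_norm p (\<lambda>i. y i - x i) < \<epsilon>"
  using Metric_space.in_mball[OF lp_Metric_space[OF assms]]
  by (auto simp: lp_dist_def lp_norm_minus_commute[of p x y])

lemma lp_SOT_continuous_eval:
  assumes "x \<in> lp_space p"
  shows "continuous_map (lp_SOT p) (lp_topology p) (\<lambda>T. T x)"
  unfolding lp_SOT_def
  by (intro continuous_map_from_subtopology continuous_map_product_projection assms)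

text \<open>Induction on \<open>n\<close> with the splitting
  \<open>S^(n+1) x - T^(n+1) x = S (S^n x - T^n x) + (S - T) (T^n x)\<close>. The first summand is
  no larger than \<open>S^n x - T^n x\<close> because \<open>S\<close> is a contraction; the second
  is controlled by evaluation at one fixed vector.\<close>

lemma lp_SOT_continuous_eval_funpow:
  assumes p: "1 \<le> p" and x: "x \<in> lp_space p"
  shows "continuous_map (lp_SOT p) (lp_topology p) (\<lambda>T. (T ^^ n) x)"
proof (induction n)
  case 0
  then show ?case using x p by (simp add: topspace_lp_topology)
next
  case (Suc n)
  note metric = Metric_space.continuous_map_to_metric[OF lp_Metric_space[OF p], folded lp_topology_def]
  show ?case
    unfolding metric topspace_lp_SOT[OF p]
  proof (intro ballI allI impI)
    fix T and \<epsilon> :: real assume T: "T \<in> lp_contractions p" and \<epsilon>: "0 < \<epsilon>"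
    have Tx: "(S ^^ n) x \<in> lp_space p" if "S \<in> lp_contractions p" for S
      using lp_nonexpansive_funpow[OF lp_contractions_nonexpansive[OF p that]] x
      by (simp add: lp_nonexpansive_def)
    obtain U where U: "openin (lp_SOT p) U" "T \<in> U"
      "\<forall>S\<in>U. (S ^^ n) x \<in> Metric_space.mball (lp_space p) (lp_dist p) ((T ^^ n) x) (\<epsilon> / 2)"
      using Suc.IH[unfolded metric topspace_lp_SOT[OF p], rule_format, OF T half_gt_zero[OF \<epsilon>]]
      by blast
    obtain V where V: "openin (lp_SOT p) V" "T \<in> V"
      "\<forall>S\<in>V. S ((T ^^ n) x) \<in> Metric_space.mball (lp_space p) (lp_dist p) (T ((T ^^ n) x)) (\<epsilon> / 2)"
      using lp_SOT_continuous_eval[OF Tx[OF T], unfolded metric topspace_lp_SOT[OF p],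
          rule_format, OF T half_gt_zero[OF \<epsilon>]]
      by blast
    show "\<exists>U. openin (lp_SOT p) U \<and> T \<in> U \<and>
      (\<forall>S\<in>U. (S ^^ Suc n) x \<in> Metric_space.mball (lp_space p) (lp_dist p) ((T ^^ Suc n) x) \<epsilon>)"
    proof (intro exI[of _ "U \<inter> V"] conjI ballI)
      fix S assume S: "S \<in> U \<inter> V"
      then have Sc: "S \<in> lp_contractions p"
        using openin_subset[OF U(1)] topspace_lp_SOT[OF p] by auto
      note SN = lp_contractions_nonexpansive[OF p Sc] and TN = lp_contractions_nonexpansive[OF p T]
      let ?a = "\<lambda>i. S ((S ^^ n) x) i - S ((T ^^ n) x) i"
      let ?b = "\<lambda>i. S ((T ^^ n) x) i - T ((T ^^ n) x) i"
      have in_lp: "S ((S ^^ n) x) \<in> lp_space p" "S ((T ^^ n) x) \<in> lp_space p" "T ((T ^^ n) x) \<in> lp_space p"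
        using SN TN Tx[OF T] Tx[OF Sc] by (auto simp: lp_nonexpansive_def)
      have "?a = S (\<lambda>i. (S ^^ n) x i - (T ^^ n) x i)"
        using lp_nonexpansive_diff[OF p SN Tx[OF Sc] Tx[OF T]] by simp
      then have "lp_norm p ?a \<le> lp_norm p (\<lambda>i. (S ^^ n) x i - (T ^^ n) x i)"
        using SN lp_space_diff[OF p Tx[OF Sc] Tx[OF T]] by (simp add: lp_nonexpansive_def)
      moreover have "lp_norm p (\<lambda>i. ?a i + ?b i) \<le> lp_norm p ?a + lp_norm p ?b"
        by (intro lp_norm_triangle lp_space_diff p in_lp)
      ultimately have "lp_norm p (\<lambda>i. S ((S ^^ n) x) i - T ((T ^^ n) x) i) < \<epsilon>"
        using bspec[OF U(3), of S] bspec[OF V(3), of S] S by (simp add: lp_mball[OF p])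
      then show "(S ^^ Suc n) x \<in> Metric_space.mball (lp_space p) (lp_dist p) ((T ^^ Suc n) x) \<epsilon>"
        using in_lp by (simp add: lp_mball[OF p])
    qed (use U V in auto)
  qed
qed

text \<open>Norm convergence at every point is convergence in the product topology, so a sequence
  from \<open>U\<close> approximating \<open>T\<close> in this sense eventually enters any open set
  around \<open>T\<close>.\<close>

lemma lp_SOT_dense:
  assumes p: "1 \<le> p" and U: "U \<subseteq> lp_contractions p"
    and approx: "\<And>T. T \<in> lp_contractions p \<Longrightarrow> \<exists>S. (\<forall>k. S k \<in> U) \<and>
      (\<forall>x\<in>lp_space p. (\<lambda>k. lp_norm p (\<lambda>i. S k x i - T x i)) \<longlonglongrightarrow> 0)"
  shows "lp_SOT p closure_of U = topspace (lp_SOT p)"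
  unfolding dense_intersects_open
proof (intro allI impI, elim conjE)
  fix W assume W: "openin (lp_SOT p) W" "W \<noteq> {}"
  then obtain T where TW: "T \<in> W" by blast
  then have T: "T \<in> lp_contractions p"
    using openin_subset[OF W(1)] topspace_lp_SOT[OF p] by auto
  obtain S where SU: "\<And>k. S k \<in> U"
    and S: "\<And>x. x \<in> lp_space p \<Longrightarrow> (\<lambda>k. lp_norm p (\<lambda>i. S k x i - T x i)) \<longlonglongrightarrow> 0"
    using approx[OF T] by blast
  have ct: "R \<in> lp_space p \<rightarrow>\<^sub>E lp_space p" if "R \<in> lp_contractions p" for R
    using that by (simp add: lp_contractions_def lp_operator_def)
  have Sc: "S k \<in> lp_contractions p" for k using SU U by auto
  interpret Metric_space "lp_space p" "lp_dist p" using p by (rule lp_Metric_space)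
  have "limitin (lp_topology p) (\<lambda>k. S k x) (T x) sequentially" if x: "x \<in> lp_space p" for x
    unfolding lp_topology_def limitin_metric
  proof (intro conjI allI impI)
    show "T x \<in> lp_space p" using ct[OF T] x by auto
    fix \<epsilon> :: real assume "0 < \<epsilon>"
    then have "\<forall>\<^sub>F k in sequentially. lp_norm p (\<lambda>i. S k x i - T x i) < \<epsilon>"
      using order_tendstoD(2)[OF S[OF x]] by blast
    then show "\<forall>\<^sub>F k in sequentially. S k x \<in> lp_space p \<and> lp_dist p (S k x) (T x) < \<epsilon>"
      by (rule eventually_mono) (use ct[OF Sc] x in \<open>auto simp: lp_dist_def\<close>)
  qed
  then have "limitin (lp_SOT p) S T sequentially"
    unfolding lp_SOT_def limitin_subtopology limitin_componentwise
    using ct[OF T] ct[OF Sc] T Sc p by (auto simp: PiE_iff topspace_lp_topology)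
  then have "\<forall>\<^sub>F k in sequentially. S k \<in> W"
    using W(1) TW by (simp add: limitin_def)
  then obtain k where "S k \<in> W"
    using eventually_happens'[OF sequentially_bot] by blast
  then show "U \<inter> W \<noteq> {}" using SU by blast
qed

text \<open>Openness is continuity of the iterates. For density, the norm of
  \<open>(s T)^n x\<close> is at most \<open>s^n\<close> times that of \<open>x\<close>, and
  \<open>s T\<close> tends to \<open>T\<close> strongly as \<open>s\<close> tends to 1. One small
  power is enough to ask for, since later iterates under a contraction are no larger.\<close>

lemma generic_small_power:
  assumes p: "1 \<le> p" and x: "x \<in> lp_space p" and \<epsilon>: "0 < \<epsilon>"
  defines "U \<equiv> {T \<in> lp_contractions p. \<exists>n. lp_norm p ((T ^^ n) x) < \<epsilon>}"
  shows "openin (lp_SOT p) U" and "lp_SOT p closure_of U = topspace (lp_SOT p)"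
proof -
  let ?B = "Metric_space.mball (lp_space p) (lp_dist p) (\<lambda>_. 0) \<epsilon>"
  have mem: "(T ^^ n) x \<in> lp_space p" if "T \<in> lp_contractions p" for T n
    using lp_nonexpansive_funpow[OF lp_contractions_nonexpansive[OF p that]] x
    by (simp add: lp_nonexpansive_def)
  have "U = (\<Union>n. {T \<in> topspace (lp_SOT p). (T ^^ n) x \<in> ?B})"
    unfolding U_def using mem by (auto simp: lp_mball p topspace_lp_SOT lp_space_zero)
  moreover have "openin (lp_topology p) ?B"
    unfolding lp_topology_def using Metric_space.openin_mball[OF lp_Metric_space[OF p]] .
  ultimately show "openin (lp_SOT p) U"
    using openin_continuous_map_preimage[OF lp_SOT_continuous_eval_funpow[OF p x]] by auto
  show "lp_SOT p closure_of U = topspace (lp_SOT p)"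
  proof (rule lp_SOT_dense[OF p])
    show "U \<subseteq> lp_contractions p" by (auto simp: U_def)
    fix T assume T: "T \<in> lp_contractions p"
    note TN = lp_contractions_nonexpansive[OF p T]
    define s where "s k = 1 - inverse (real (Suc k))" for k
    have s: "0 \<le> s k" "s k < 1" for k by (auto simp: s_def field_simps)
    define S where "S k = restrict (\<lambda>y i. complex_of_real (s k) * T y i) (lp_space p)" for k
    have norm_S: "lp_norm p (\<lambda>i. complex_of_real (s k) * T y i) = s k * lp_norm p (T y)"
      if "y \<in> lp_space p" for y k
      using TN that p s[of k] by (simp add: lp_norm_scale lp_nonexpansive_def)
    have "lp_nonexpansive p (\<lambda>y i. complex_of_real (s k) * T y i)" for k
      unfolding lp_nonexpansive_def
    proof (intro conjI ballI allI)
      fix y assume y: "y \<in> lp_space p"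
      have "s k * lp_norm p (T y) \<le> 1 * lp_norm p y"
        using TN y s[of k] by (intro mult_mono) (auto simp: lp_nonexpansive_def lp_norm_nonneg)
      then show "lp_norm p (\<lambda>i. complex_of_real (s k) * T y i) \<le> lp_norm p y"
        using norm_S[OF y] by simp
    qed (use TN in \<open>auto simp: lp_nonexpansive_def lp_space_scale distrib_left mult.left_commute\<close>)
    then have Sc: "S k \<in> lp_contractions p" for k
      unfolding S_def by (rule restrict_in_lp_contractions[OF p])
    have pow: "lp_norm p ((S k ^^ n) x) \<le> s k ^ n * lp_norm p x" for k n
    proof (induction n)
      case (Suc n)
      have m: "(S k ^^ n) x \<in> lp_space p" using mem[OF Sc] .
      have "lp_norm p ((S k ^^ Suc n) x) = s k * lp_norm p (T ((S k ^^ n) x))"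
        using norm_S[OF m] m by (simp add: S_def)
      also have "\<dots> \<le> s k * (s k ^ n * lp_norm p x)"
        using Suc TN m s[of k] unfolding lp_nonexpansive_def
        by (intro mult_left_mono) (auto intro: order_trans)
      finally show ?case by (simp add: mult.assoc)
    qed simp
    have "\<exists>n. lp_norm p ((S k ^^ n) x) < \<epsilon>" for k
    proof -
      have "(\<lambda>n. s k ^ n * lp_norm p x) \<longlonglongrightarrow> 0 * lp_norm p x"
        using s[of k] by (intro tendsto_mult LIMSEQ_power_zero tendsto_const) auto
      then have "\<forall>\<^sub>F n in sequentially. s k ^ n * lp_norm p x < \<epsilon>"
        using \<epsilon> by (intro order_tendstoD(2)) auto
      then obtain n where "s k ^ n * lp_norm p x < \<epsilon>"
        using eventually_happens'[OF sequentially_bot] by blast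
      then show ?thesis using pow[of n k] by (intro exI[of _ n]) simp
    qed
    then have "S k \<in> U" for k using Sc by (simp add: U_def)
    moreover have "(\<lambda>k. lp_norm p (\<lambda>i. S k y i - T y i)) \<longlonglongrightarrow> 0" if y: "y \<in> lp_space p" for y
    proof -
      have "lp_norm p (\<lambda>i. S k y i - T y i) = inverse (real (Suc k)) * lp_norm p (T y)" for k
      proof -
        have "(\<lambda>i. S k y i - T y i) = (\<lambda>i. complex_of_real (- inverse (real (Suc k))) * T y i)"
          using y by (simp add: S_def s_def algebra_simps)
        then show ?thesis
          using lp_norm_scale[OF p, of "T y" "complex_of_real (- inverse (real (Suc k)))"] TN y
          by (simp only: lp_nonexpansive_def norm_of_real) simp
      qed
      then show ?thesis
        using tendsto_mult[OF LIMSEQ_inverse_real_of_nat tendsto_const, of "lp_norm p (T y)"] by simp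
    qed
    ultimately show "\<exists>S. (\<forall>k. S k \<in> U) \<and>
      (\<forall>x\<in>lp_space p. (\<lambda>k. lp_norm p (\<lambda>i. S k x i - T x i)) \<longlonglongrightarrow> 0)"
      by blast
  qed
qed

text \<open>The coordinates below \<open>M\<close> and the coordinate \<open>M\<close> form disjoint
  blocks, so \<open>p\<close>-th powers of norms add up and each block is estimated separately. This
  makes the operator \<open>R M\<close> in \<open>generic_almost_eigenvector\<close>
  non-expansive.\<close>

lemma lp_norm_trunc_append_le:
  assumes p: "1 \<le> p" and x: "x \<in> lp_space p" and y: "y \<in> lp_space p"
    and le: "lp_norm p y \<le> lp_norm p (lp_trunc M x)" and r: "norm r \<le> 1"
  defines "z \<equiv> \<lambda>i. lp_trunc M y i + r * x M * lp_unit M i"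
  shows "lp_norm p z \<le> lp_norm p x"
proof (rule lp_norm_leI[OF p _ x])
  have z: "z i = (if i < M then y i else if i = M then r * x M else 0)" for i
    by (auto simp: z_def lp_trunc_def lp_unit_def)
  show "z \<in> lp_space p"
    unfolding z_def using p y
    by (intro lp_space_add lp_trunc_in lp_space_scale lp_unit_in)
  have "(\<Sum>i. norm (z i) powr p) = (\<Sum>i<Suc M. norm (z i) powr p)"
    by (rule suminf_finite) (auto simp: z)
  also have "\<dots> = (\<Sum>i<M. norm (y i) powr p) + norm (r * x M) powr p"
    by (simp add: z)
  also have "(\<Sum>i<M. norm (y i) powr p) \<le> (\<Sum>i. norm (y i) powr p)"
    using y by (intro sum_le_suminf) (auto simp: lp_space_def)
  also have "\<dots> = lp_norm p y powr p" using lp_norm_powr[OF p y] by simp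
  also have "\<dots> \<le> lp_norm p (lp_trunc M x) powr p"
    using le p by (intro powr_mono2) (auto simp: lp_norm_nonneg)
  also have "\<dots> = (\<Sum>i. norm (lp_trunc M x i) powr p)"
    using lp_norm_powr[OF p lp_trunc_in[OF p x]] .
  also have "\<dots> = (\<Sum>i<M. norm (lp_trunc M x i) powr p)"
    by (rule suminf_finite) (auto simp: lp_trunc_def)
  also have "\<dots> = (\<Sum>i<M. norm (x i) powr p)" by (simp add: lp_trunc_def)
  also have "norm (r * x M) powr p \<le> norm (x M) powr p"
    using r p by (intro powr_mono2) (auto simp: norm_mult mult_left_le_one_le)
  also have "(\<Sum>i<M. norm (x i) powr p) + norm (x M) powr p = (\<Sum>i<Suc M. norm (x i) powr p)"
    by simp
  also have "\<dots> \<le> (\<Sum>i. norm (x i) powr p)"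
    using x by (intro sum_le_suminf) (auto simp: lp_space_def)
  finally show "(\<Sum>i. norm (z i) powr p) \<le> (\<Sum>i. norm (x i) powr p)" by simp
qed

text \<open>For density, \<open>T\<close> is replaced by the block operator that compresses
  \<open>T\<close> to the coordinates below \<open>M\<close> and multiplies coordinate
  \<open>M\<close> by \<open>r\<close>. It has an exact eigenvector at \<open>M\<close> and tends to
  \<open>T\<close> strongly as \<open>M\<close> grows, since only tails of \<open>x\<close> and
  \<open>T x\<close> enter the error.\<close>

lemma generic_almost_eigenvector:
  fixes r \<delta> :: real and N :: nat
  assumes p: "1 \<le> p" and r: "0 \<le> r" "r \<le> 1" and \<delta>: "0 < \<delta>"
  defines "U \<equiv> {T \<in> lp_contractions p. \<exists>m\<ge>N. lp_norm p (\<lambda>i. T (lp_unit m) i - r * lp_unit m i) < \<delta>}"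
  shows "openin (lp_SOT p) U" and "lp_SOT p closure_of U = topspace (lp_SOT p)"
proof -
  let ?B = "\<lambda>m. Metric_space.mball (lp_space p) (lp_dist p) (\<lambda>i. complex_of_real r * lp_unit m i) \<delta>"
  have mem: "T x \<in> lp_space p" if "T \<in> lp_contractions p" "x \<in> lp_space p" for T x
    using lp_contractions_nonexpansive[OF p that(1)] that(2) by (simp add: lp_nonexpansive_def)
  have "U = (\<Union>m\<in>{N..}. {T \<in> topspace (lp_SOT p). T (lp_unit m) \<in> ?B m})"
    unfolding U_def using mem
    by (auto simp: lp_mball p topspace_lp_SOT lp_unit_in lp_space_scale)
  moreover have "openin (lp_topology p) (?B m)" for m
    unfolding lp_topology_def using Metric_space.openin_mball[OF lp_Metric_space[OF p]] .
  ultimately show "openin (lp_SOT p) U"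
    using openin_continuous_map_preimage[OF lp_SOT_continuous_eval[OF lp_unit_in[OF p]]] by auto
  show "lp_SOT p closure_of U = topspace (lp_SOT p)"
  proof (rule lp_SOT_dense[OF p])
    show "U \<subseteq> lp_contractions p" by (auto simp: U_def)
    fix T assume T: "T \<in> lp_contractions p"
    note TN = lp_contractions_nonexpansive[OF p T]
    define R where "R M x = (\<lambda>i. lp_trunc M (T (lp_trunc M x)) i + complex_of_real r * x M * lp_unit M i)" for M x
    have Tt: "T (lp_trunc M x) \<in> lp_space p" if "x \<in> lp_space p" for M x
      using mem[OF T] lp_trunc_in[OF p that] by blast
    have RN: "lp_nonexpansive p (R M)" for M
      unfolding lp_nonexpansive_def
    proof (intro conjI ballI allI)
      fix x assume x: "x \<in> lp_space p"
      show "R M x \<in> lp_space p"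
        unfolding R_def using p Tt[OF x] by (intro lp_space_add lp_trunc_in lp_space_scale lp_unit_in)
      show "lp_norm p (R M x) \<le> lp_norm p x"
        unfolding R_def
        by (rule lp_norm_trunc_append_le)
           (use p x Tt[OF x] r TN lp_trunc_in[OF p x] in \<open>auto simp: lp_nonexpansive_def\<close>)
    next
      fix x y assume x: "x \<in> lp_space p" and y: "y \<in> lp_space p"
      have "lp_trunc M (\<lambda>n. x n + y n) = (\<lambda>n. lp_trunc M x n + lp_trunc M y n)"
        by (auto simp: lp_trunc_def)
      then have "T (lp_trunc M (\<lambda>n. x n + y n)) = (\<lambda>n. T (lp_trunc M x) n + T (lp_trunc M y) n)"
        using TN lp_trunc_in[OF p] x y by (simp add: lp_nonexpansive_def)
      then show "R M (\<lambda>n. x n + y n) = (\<lambda>n. R M x n + R M y n)"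
        by (auto simp: R_def lp_trunc_def algebra_simps)
    next
      fix c x assume x: "x \<in> lp_space p"
      have "lp_trunc M (\<lambda>n. c * x n) = (\<lambda>n. c * lp_trunc M x n)"
        by (auto simp: lp_trunc_def)
      then have "T (lp_trunc M (\<lambda>n. c * x n)) = (\<lambda>n. c * T (lp_trunc M x) n)"
        using TN lp_trunc_in[OF p] x by (simp add: lp_nonexpansive_def)
      then show "R M (\<lambda>n. c * x n) = (\<lambda>n. c * R M x n)"
        by (auto simp: R_def lp_trunc_def algebra_simps)
    qed
    define S where "S k = restrict (R (N + k)) (lp_space p)" for k
    have Sc: "S k \<in> lp_contractions p" for k
      unfolding S_def by (rule restrict_in_lp_contractions[OF p RN])
    have "S k \<in> U" for k
    proof -
      \<comment> \<open>\<open>lp_trunc M\<close> keeps the coordinates strictly below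
        \<open>M\<close>, so it kills \<open>lp_unit M\<close> and only the diagonal entry
        \<open>r\<close> acts on that vector.\<close>
      have "lp_trunc M (lp_unit M) = (\<lambda>n. 0 * lp_unit M n)" for M
        by (auto simp: lp_trunc_def lp_unit_def)
      then have "T (lp_trunc M (lp_unit M)) = (\<lambda>n. 0)" for M
        using TN lp_unit_in[OF p, of M] unfolding lp_nonexpansive_def by (metis mult_zero_left)
      then have "S k (lp_unit (N + k)) = (\<lambda>i. complex_of_real r * lp_unit (N + k) i)"
        by (auto simp: S_def R_def lp_unit_in p lp_trunc_def) (auto simp: lp_unit_def)
      then have "lp_norm p (\<lambda>i. S k (lp_unit (N + k)) i - complex_of_real r * lp_unit (N + k) i) < \<delta>"
        using \<delta> p by (simp add: lp_norm_zero)
      then show ?thesis using Sc by (auto simp: U_def intro!: exI[of _ "N + k"])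
    qed
    moreover have "(\<lambda>k. lp_norm p (\<lambda>i. S k x i - T x i)) \<longlonglongrightarrow> 0" if x: "x \<in> lp_space p" for x
    proof -
      have Tx: "T x \<in> lp_space p" using mem[OF T x] .
      let ?t = "\<lambda>M. lp_norm p (\<lambda>i. x i - lp_trunc M x i)"
      let ?u = "\<lambda>M. lp_norm p (\<lambda>i. T x i - lp_trunc M (T x) i)"
      have bound: "lp_norm p (\<lambda>i. R M x i - T x i) \<le> ?t M + ?u M + ?t M" for M
      proof -
        \<comment> \<open>The error is \<open>?c - (?a + ?b)\<close>: the appended diagonal entry,
          the effect of truncating the input, and the effect of truncating the output.\<close>
        let ?a = "lp_trunc M (T (\<lambda>i. x i - lp_trunc M x i))"
        let ?b = "\<lambda>i. T x i - lp_trunc M (T x) i"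
        let ?c = "\<lambda>i. complex_of_real r * x M * lp_unit M i"
        have d: "(\<lambda>i. x i - lp_trunc M x i) \<in> lp_space p"
          using lp_space_diff[OF p x lp_trunc_in[OF p x]] .
        have a: "?a \<in> lp_space p" using d p mem[OF T] by (intro lp_trunc_in)
        have b: "?b \<in> lp_space p" using lp_space_diff[OF p Tx lp_trunc_in[OF p Tx]] .
        have c: "?c \<in> lp_space p" using p by (intro lp_space_scale lp_unit_in)
        have "(\<lambda>i. R M x i - T x i) = (\<lambda>i. ?c i - (?a i + ?b i))"
          using lp_nonexpansive_diff[OF p TN x lp_trunc_in[OF p x]]
          by (auto simp: R_def lp_trunc_def)
        then have "lp_norm p (\<lambda>i. R M x i - T x i) = lp_norm p (\<lambda>i. (?a i + ?b i) - ?c i)"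
          using lp_norm_minus_commute[of p ?c "\<lambda>i. ?a i + ?b i"] by simp
        also have "\<dots> = lp_norm p (\<lambda>i. (?a i + ?b i) + (-1) * ?c i)" by simp
        also have "\<dots> \<le> lp_norm p (\<lambda>i. ?a i + ?b i) + lp_norm p (\<lambda>i. (-1) * ?c i)"
          by (intro lp_norm_triangle[OF p] lp_space_add[OF p] lp_space_scale[OF c] a b)
        also have "lp_norm p (\<lambda>i. ?a i + ?b i) \<le> lp_norm p ?a + lp_norm p ?b"
          by (rule lp_norm_triangle[OF p a b])
        also have "lp_norm p ?a \<le> lp_norm p (T (\<lambda>i. x i - lp_trunc M x i))"
          using lp_norm_trunc_le[OF p] mem[OF T d] by blast
        also have "\<dots> \<le> ?t M" using TN d by (simp add: lp_nonexpansive_def)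
        also have "lp_norm p (\<lambda>i. (-1) * ?c i) = norm (complex_of_real r * x M)"
          using lp_norm_scale[OF p c, of "-1"] lp_norm_scale_unit[OF p] by simp
        also have "\<dots> \<le> norm (x M)"
          using r by (simp add: norm_mult mult_left_le_one_le)
        \<comment> \<open>Coordinate \<open>M\<close> is not below \<open>M\<close>, so it survives
          in the tail and is bounded by the norm of the tail.\<close>
        also have "\<dots> = norm (x M - lp_trunc M x M)" by (simp add: lp_trunc_def)
        also have "\<dots> \<le> ?t M" using lp_coord_le[OF p d, of M] .
        finally show ?thesis by simp
      qed
      have "(\<lambda>M. ?t M + ?u M + ?t M) \<longlonglongrightarrow> 0 + 0 + 0"
        by (intro tendsto_add lp_trunc_tendsto p x Tx)
      then have lim: "(\<lambda>M. ?t M + ?u M + ?t M) \<longlonglongrightarrow> 0"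
        by simp
      have "\<forall>\<^sub>F M in sequentially. norm (lp_norm p (\<lambda>i. R M x i - T x i)) \<le> ?t M + ?u M + ?t M"
        using bound by (simp add: lp_norm_nonneg)
      then have "(\<lambda>M. lp_norm p (\<lambda>i. R M x i - T x i)) \<longlonglongrightarrow> 0"
        using lim by (rule Lim_null_comparison)
      then have "(\<lambda>k. lp_norm p (\<lambda>i. R (k + N) x i - T x i)) \<longlonglongrightarrow> 0"
        by (rule LIMSEQ_ignore_initial_segment)
      then show ?thesis using x by (simp add: S_def add.commute)
    qed
    ultimately show "\<exists>S. (\<forall>k. S k \<in> U) \<and>
      (\<forall>x\<in>lp_space p. (\<lambda>k. lp_norm p (\<lambda>i. S k x i - T x i)) \<longlonglongrightarrow> 0)"
      by blast
  qed
qed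

subsection \<open>Orbits of sums of almost eigenvectors\<close>

text \<open>The errors satisfy \<open>e_(n+1) \<le> \<delta> + r * e_n\<close>, and
  \<open>\<delta> / (1 - r)\<close> is the fixed point of this recursion; hence the bound is uniform
  in \<open>n\<close>.\<close>

lemma almost_eigenvector_powers:
  fixes r \<delta> :: real
  assumes p: "1 \<le> p" and T: "lp_nonexpansive p T" and x: "x \<in> lp_space p"
    and r: "0 \<le> r" "r < 1" and \<delta>: "0 \<le> \<delta>" "lp_norm p (\<lambda>i. T x i - complex_of_real r * x i) \<le> \<delta>"
  shows "lp_norm p (\<lambda>i. (T ^^ n) x i - complex_of_real (r ^ n) * x i) \<le> \<delta> / (1 - r)"
proof (induction n)
  case 0
  show ?case using r \<delta> p by (simp add: lp_norm_zero)
next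
  case (Suc n)
  note Tn = lp_nonexpansive_funpow[OF T, of n]
  have Tx: "T x \<in> lp_space p" and Tnx: "(T ^^ n) x \<in> lp_space p"
    using T Tn x by (auto simp: lp_nonexpansive_def)
  have rx: "(\<lambda>i. complex_of_real r * x i) \<in> lp_space p" "(\<lambda>i. complex_of_real (r ^ n) * x i) \<in> lp_space p"
    using x by (auto intro: lp_space_scale)
  let ?d = "\<lambda>i. T x i - complex_of_real r * x i"
  let ?e = "\<lambda>i. (T ^^ n) x i - complex_of_real (r ^ n) * x i"
  have d: "?d \<in> lp_space p" and e: "?e \<in> lp_space p"
    using lp_space_diff[OF p Tx rx(1)] lp_space_diff[OF p Tnx rx(2)] by auto
  have "(T ^^ n) (\<lambda>i. complex_of_real r * x i) = (\<lambda>i. complex_of_real r * (T ^^ n) x i)"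
    using Tn x by (simp add: lp_nonexpansive_def)
  moreover have "(T ^^ Suc n) x = (T ^^ n) (T x)"
    by (simp only: funpow_Suc_right o_apply)
  ultimately have "(\<lambda>i. (T ^^ Suc n) x i - complex_of_real (r ^ Suc n) * x i) = (\<lambda>i. (T ^^ n) ?d i + complex_of_real r * ?e i)"
    using lp_nonexpansive_diff[OF p Tn Tx rx(1)] by (simp add: algebra_simps)
  then have "lp_norm p (\<lambda>i. (T ^^ Suc n) x i - complex_of_real (r ^ Suc n) * x i) \<le>
      lp_norm p ((T ^^ n) ?d) + lp_norm p (\<lambda>i. complex_of_real r * ?e i)"
    using lp_norm_triangle[OF p, of "(T ^^ n) ?d" "\<lambda>i. complex_of_real r * ?e i"] Tn d lp_space_scale[OF e]
    by (simp add: lp_nonexpansive_def)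
  also have "lp_norm p ((T ^^ n) ?d) \<le> \<delta>"
    using Tn d \<delta>(2) unfolding lp_nonexpansive_def by (meson order_trans)
  also have "lp_norm p (\<lambda>i. complex_of_real r * ?e i) = r * lp_norm p ?e"
    using lp_norm_scale[OF p e, of "complex_of_real r"] r by simp
  also have "\<dots> \<le> r * (\<delta> / (1 - r))"
    using Suc r by (intro mult_left_mono) auto
  also have "\<delta> + r * (\<delta> / (1 - r)) = \<delta> / (1 - r)"
    using r by (simp add: field_simps)
  finally show ?case by simp
qed

lemma summable_in_lp_space:
  assumes "1 \<le> p" "\<And>i. 0 \<le> b i" "\<And>i. b i \<le> 1" "summable b"
  shows "(\<lambda>i. complex_of_real (b i)) \<in> lp_space p"
proof -
  have "b i powr p \<le> b i" for i
    using powr_mono'[of 1 p "b i"] assms by simp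
  then have "summable (\<lambda>i. norm (complex_of_real (b i)) powr p)"
    by (intro summable_comparison_test'[OF assms(4), of 0]) (use assms(2) in auto)
  then show ?thesis by (simp add: lp_space_def)
qed

text \<open>Expanded along unit vectors, the value is close to \<open>M\<close>, the sum of all
  \<open>b i * (b' i * \<mu> i)\<close>. Replacing \<open>S (lp_unit i)\<close> by
  \<open>\<mu> i\<close> times \<open>lp_unit i\<close> costs at most
  \<open>b i * (4 * \<rho>)\<close>, in total \<open>8 * \<rho>\<close>, while the single term at
  \<open>i0\<close> already makes \<open>M\<close> at least \<open>16 * \<rho>\<close>. In the
  application \<open>S\<close> is a power of \<open>T\<close>.\<close>

lemma lp_weighted_orbit_near_positive:
  fixes b b' \<mu> :: "nat \<Rightarrow> real" and \<rho> :: real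
  assumes p: "1 \<le> p" and S: "lp_nonexpansive p S"
    and b: "\<And>i. 0 \<le> b i" "\<And>i. b i \<le> 1" "summable b" "suminf b \<le> 2"
    and b': "\<And>i. b i \<le> b' i" "summable b'" "suminf b' \<le> 4"
    and \<mu>: "\<And>i. 0 \<le> \<mu> i" "\<And>i. \<mu> i \<le> 1"
    and \<rho>: "0 < \<rho>" "\<And>i. 0 < b i \<Longrightarrow> lp_norm p (\<lambda>j. S (lp_unit i) j - \<mu> i * lp_unit i j) \<le> \<rho>"
    and large: "16 * \<rho> \<le> b i0 * b i0 * \<mu> i0"
  shows "\<exists>M>0. norm (lp_weighted b' (S (\<lambda>i. complex_of_real (b i))) - complex_of_real M) \<le> M / 2"
proof -
  define f where "f = lp_weighted b'"
  define M where "M = (\<Sum>i. b i * (b' i * \<mu> i))"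
  have b'0: "0 \<le> b' i" for i using b(1) b'(1) order_trans by blast
  have F: "lp_functional p (suminf b') f"
    unfolding f_def by (rule lp_weighted_functional[OF p b'0 b'(2)])
  have "0 \<le> suminf b'" using b'0 b'(2) by (rule suminf_nonneg[rotated])
  then have fS: "lp_functional p (suminf b') (\<lambda>x. f (S x))"
    by (rule lp_functional_comp[OF F S])
  let ?x = "\<lambda>i. complex_of_real (b i)"
  have sums: "(\<lambda>i. ?x i * f (S (lp_unit i))) sums f (S ?x)"
    using lp_functional_sums[OF p fS summable_in_lp_space[OF p b(1,2,3)]] .
  have b'4: "b' i * \<mu> i \<le> 4" for i
  proof -
    have "b' i \<le> suminf b'" using sum_le_suminf[OF b'(2), of "{i}"] b'0 by simp
    moreover have "b' i * \<mu> i \<le> b' i * 1" using b'0 \<mu> by (intro mult_left_mono) auto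
    ultimately show ?thesis using b'(3) by linarith
  qed
  have sM: "summable (\<lambda>i. b i * (b' i * \<mu> i))"
  proof (rule summable_comparison_test'[of "\<lambda>i. b i * 4" 0])
    show "norm (b i * (b' i * \<mu> i)) \<le> b i * 4" for i
      using b(1) b'0 \<mu>(1) b'4 by (simp add: mult_left_mono)
  qed (use b in \<open>auto intro: summable_mult2\<close>)
  have "b i0 * (b i0 * \<mu> i0) \<le> b i0 * (b' i0 * \<mu> i0)"
    using b b' \<mu> by (intro mult_left_mono mult_right_mono) auto
  also have "\<dots> \<le> M"
    unfolding M_def using sum_le_suminf[OF sM, of "{i0}"] b(1) b'0 \<mu>(1) by simp
  finally have M: "16 * \<rho> \<le> M" using large by (simp add: mult.assoc)
  have term_le: "norm (?x i * f (S (lp_unit i)) - complex_of_real (b i * (b' i * \<mu> i))) \<le> b i * (4 * \<rho>)" for i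
  \<comment> \<open>Off the support of \<open>b\<close> nothing is known about
    \<open>S (lp_unit i)\<close>, but there both terms vanish.\<close>
  proof (cases "b i = 0")
    case False
    then have "0 < b i" using b(1)[of i] by simp
    have u: "S (lp_unit i) \<in> lp_space p" "(\<lambda>j. complex_of_real (\<mu> i) * lp_unit i j) \<in> lp_space p"
      using S lp_unit_in[OF p] lp_space_scale by (auto simp: lp_nonexpansive_def)
    have "f (\<lambda>j. complex_of_real (\<mu> i) * lp_unit i j) = complex_of_real (b' i * \<mu> i)"
      using F lp_unit_in[OF p, of i] lp_weighted_unit[of b' i] by (simp add: lp_functional_def f_def)
    then have "norm (f (S (lp_unit i)) - complex_of_real (b' i * \<mu> i)) =
        norm (f (\<lambda>j. S (lp_unit i) j - complex_of_real (\<mu> i) * lp_unit i j))"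
      using lp_functional_diff[OF p F u] by simp
    also have "\<dots> \<le> suminf b' * lp_norm p (\<lambda>j. S (lp_unit i) j - complex_of_real (\<mu> i) * lp_unit i j)"
      using F lp_space_diff[OF p u] by (simp add: lp_functional_def)
    also have "\<dots> \<le> 4 * \<rho>"
      using \<rho>(2)[OF \<open>0 < b i\<close>] b'(3) by (intro mult_mono) (auto simp: lp_norm_nonneg)
    finally have *: "norm (f (S (lp_unit i)) - complex_of_real (b' i * \<mu> i)) \<le> 4 * \<rho>" .
    have "?x i * f (S (lp_unit i)) - complex_of_real (b i * (b' i * \<mu> i)) =
        ?x i * (f (S (lp_unit i)) - complex_of_real (b' i * \<mu> i))"
      by (simp add: right_diff_distrib)
    then have "norm (?x i * f (S (lp_unit i)) - complex_of_real (b i * (b' i * \<mu> i))) =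
        b i * norm (f (S (lp_unit i)) - complex_of_real (b' i * \<mu> i))"
      using b(1)[of i] by (simp only: norm_mult norm_of_real abs_of_nonneg)
    also have "\<dots> \<le> b i * (4 * \<rho>)" using * b(1) by (rule mult_left_mono)
    finally show ?thesis .
  qed simp
  have diff: "(\<lambda>i. ?x i * f (S (lp_unit i)) - complex_of_real (b i * (b' i * \<mu> i))) sums
      (f (S ?x) - complex_of_real M)"
    unfolding M_def using sums sM by (intro sums_diff sums_of_real summable_sums)
  have "norm (f (S ?x) - complex_of_real M) \<le> (\<Sum>i. b i * (4 * \<rho>))"
    unfolding sums_unique[OF diff] by (rule norm_suminf_le[OF term_le summable_mult2[OF b(3)]])
  also have "\<dots> = suminf b * (4 * \<rho>)" using suminf_mult2[OF b(3)] by simp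
  also have "\<dots> \<le> 2 * (4 * \<rho>)" using b \<rho>(1) by (intro mult_right_mono) auto
  also have "\<dots> \<le> M / 2" using M by simp
  finally show ?thesis using M \<rho>(1) unfolding f_def by (intro exI[of _ M]) auto
qed

text \<open>One stage of the construction. \<open>K\<close> and \<open>N0\<close> are the coordinate
  and the time of the preceding stage: the new eigenvalue must not have lost more than half by time
  \<open>N0\<close>, and from the new time \<open>N\<close> on all unit vectors up to the new one
  have decayed.\<close>

lemma almost_eigenvector_step:
  fixes \<epsilon> :: real
  assumes p: "1 \<le> p" and T: "lp_nonexpansive p T"
    and small: "\<And>m \<epsilon>. 0 < \<epsilon> \<Longrightarrow> \<exists>n. lp_norm p ((T ^^ n) (lp_unit m)) < \<epsilon>"
    and eig: "\<And>k N \<delta>. 0 < \<delta> \<Longrightarrow> \<exists>m\<ge>N.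
      lp_norm p (\<lambda>i. T (lp_unit m) i - complex_of_real (1 - 1 / (real k + 2)) * lp_unit m i) < \<delta>"
    and \<epsilon>: "0 < \<epsilon>"
  shows "\<exists>m r N. K < m \<and> N0 < N \<and> 0 \<le> r \<and> r \<le> 1 \<and> 1 / 2 \<le> r ^ N0 \<and>
    (\<forall>n. lp_norm p (\<lambda>i. (T ^^ n) (lp_unit m) i - complex_of_real (r ^ n) * lp_unit m i) \<le> \<epsilon>) \<and>
    (\<forall>n\<ge>N. \<forall>j\<le>m. lp_norm p ((T ^^ n) (lp_unit j)) \<le> \<epsilon>)"
proof -
  \<comment> \<open>\<open>N0 * (1 - r)\<close> is below 1/2, so Bernoulli's inequality gives
    \<open>1 / 2 \<le> r ^ N0\<close>. This is the value that \<open>eig\<close> offers for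
    \<open>k = 2 * N0\<close>.\<close>
  define r where "r = 1 - 1 / (real (2 * N0) + 2)"
  have r: "0 \<le> r" "r < 1" by (auto simp: r_def field_simps)
  have "1 / 2 \<le> 1 + real N0 * (- 1 / (real (2 * N0) + 2))"
    by (simp add: field_simps)
  also have "\<dots> \<le> (1 + (- 1 / (real (2 * N0) + 2))) ^ N0"
    by (rule Bernoulli_inequality) (simp add: field_simps)
  finally have rN: "1 / 2 \<le> r ^ N0" by (simp add: r_def)
  \<comment> \<open>The tolerance \<open>\<epsilon> * (1 - r)\<close> cancels the factor
    \<open>1 / (1 - r)\<close> lost in \<open>almost_eigenvector_powers\<close>.\<close>
  obtain m where m: "Suc K \<le> m" and
    "lp_norm p (\<lambda>i. T (lp_unit m) i - complex_of_real r * lp_unit m i) < \<epsilon> * (1 - r)"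
    using eig[of "\<epsilon> * (1 - r)" "Suc K" "2 * N0"] \<epsilon> r unfolding r_def by auto
  then have "lp_norm p (\<lambda>i. (T ^^ n) (lp_unit m) i - complex_of_real (r ^ n) * lp_unit m i) \<le> \<epsilon>" for n
    using almost_eigenvector_powers[OF p T lp_unit_in[OF p, of m] r, of "\<epsilon> * (1 - r)" n] \<epsilon> r by simp
  moreover obtain N' where N': "\<And>j. lp_norm p ((T ^^ N' j) (lp_unit j)) < \<epsilon>"
    using small[OF \<epsilon>] by metis
  \<comment> \<open>The sum dominates every \<open>N' j\<close> with \<open>j \<le> m\<close>, and
    after time \<open>N' j\<close> the norm cannot grow again. The \<open>Suc\<close> makes
    \<open>N0 < N\<close> strict.\<close>
  define N where "N = Suc N0 + (\<Sum>j\<le>m. N' j)"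
  have "lp_norm p ((T ^^ n) (lp_unit j)) \<le> \<epsilon>" if "N \<le> n" "j \<le> m" for n j
  proof -
    have "N' j \<le> (\<Sum>j\<le>m. N' j)" using that by (intro member_le_sum) auto
    then have "n = (n - N' j) + N' j" using that(1) by (simp add: N_def)
    then have "(T ^^ n) (lp_unit j) = (T ^^ (n - N' j)) ((T ^^ N' j) (lp_unit j))"
      by (metis funpow_add o_apply)
    moreover have "(T ^^ N' j) (lp_unit j) \<in> lp_space p"
      using lp_nonexpansive_funpow[OF T] lp_unit_in[OF p] by (simp add: lp_nonexpansive_def)
    ultimately show ?thesis
      using lp_nonexpansive_funpow[OF T, of "n - N' j"] N'[of j] unfolding lp_nonexpansive_def
      by (metis less_eq_real_def order_trans)
  qed
  moreover have "N0 < N" by (simp add: N_def)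
  ultimately show ?thesis
    using m r rN by (intro exI[of _ m] exI[of _ r] exI[of _ N]) auto
qed

text \<open>Weight \<open>(1 / 2) ^ k\<close> sits on the unit vector of stage \<open>k\<close>. At
  time \<open>n\<close>, let \<open>K\<close> be the first stage with \<open>n \<le> N K\<close>.
  Earlier stages have decayed, stages from \<open>K\<close> on still behave like eigenvectors, and
  stage \<open>K + 1\<close> keeps at least half its size. Errors of order
  \<open>(1 / 4) ^ K\<close>, the scale of the squared weights, are beaten by that one term.\<close>

lemma exists_almost_eigenvector_sum:
  assumes p: "1 \<le> p" and T: "lp_nonexpansive p T"
    and small: "\<And>m \<epsilon>. 0 < \<epsilon> \<Longrightarrow> \<exists>n. lp_norm p ((T ^^ n) (lp_unit m)) < \<epsilon>"
    and eig: "\<And>k N \<delta>. 0 < \<delta> \<Longrightarrow> \<exists>m\<ge>N.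
      lp_norm p (\<lambda>i. T (lp_unit m) i - complex_of_real (1 - 1 / (real k + 2)) * lp_unit m i) < \<delta>"
  obtains b :: "nat \<Rightarrow> real" and m0 m1 :: nat
  where "\<And>i. 0 \<le> b i" "\<And>i. b i \<le> 1" "b sums 2" "m0 \<noteq> m1" "b m0 = 1" "b m1 = 1 / 2"
    "\<And>n. \<exists>\<rho> \<mu> i0. 0 < \<rho> \<and> (\<forall>i. 0 \<le> \<mu> i) \<and> (\<forall>i. \<mu> i \<le> 1) \<and>
      (\<forall>i. 0 < b i \<longrightarrow> lp_norm p (\<lambda>j. (T ^^ n) (lp_unit i) j - complex_of_real (\<mu> i) * lp_unit i j) \<le> \<rho>) \<and>
      16 * \<rho> \<le> b i0 * b i0 * \<mu> i0"
proof -
  \<comment> \<open>With \<open>\<rho> = 4 \<eta> K\<close> below, \<open>16 \<rho>\<close> is exactly half of the squared weight \<open>(1/4)\<^sup>K\<^sup>+\<^sup>1\<close>.\<close>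
  define \<eta> :: "nat \<Rightarrow> real" where "\<eta> k = (1 / 4) ^ k / 512" for k
  \<comment> \<open>A stage is a triple of coordinate, eigenvalue and decay time. \<open>P\<close>
    is the requirement on stage \<open>k\<close>, and \<open>Q\<close> links consecutive stages for
    the dependent choice.\<close>
  define P where "P k s = (case s of (m, r, N) \<Rightarrow> 0 \<le> r \<and> r \<le> 1 \<and>
    (\<forall>n. lp_norm p (\<lambda>i. (T ^^ n) (lp_unit m) i - complex_of_real (r ^ n) * lp_unit m i) \<le> \<eta> k) \<and>
    (\<forall>n\<ge>N. \<forall>j\<le>m. lp_norm p ((T ^^ n) (lp_unit j)) \<le> \<eta> k))"
    for k and s :: "nat \<times> real \<times> nat"
  define Q where "Q s s' = (case s of (m, r, N) \<Rightarrow> case s' of (m', r', N') \<Rightarrow>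
    m < m' \<and> N < N' \<and> 1 / 2 \<le> r' ^ N)"
    for s s' :: "nat \<times> real \<times> nat"
  have \<eta>0: "0 < \<eta> k" for k by (simp add: \<eta>_def)
  note step = almost_eigenvector_step[OF p T small eig \<eta>0]
  have "\<exists>s. P 0 s"
    using step[of 0 0 0] unfolding P_def by fast
  moreover have "\<exists>s'. P (Suc k) s' \<and> Q s s'" for s k
  proof -
    obtain m r N where s: "s = (m, r, N)" by (cases s)
    show ?thesis using step[of m N "Suc k"] unfolding P_def Q_def s by fast
  qed
  ultimately obtain s where s: "\<And>k. P k (s k)" "\<And>k. Q (s k) (s (Suc k))"
    using dependent_nat_choice[of P "\<lambda>_. Q"] by metis
  define m r N where "m k = fst (s k)" and "r k = fst (snd (s k))" and "N k = snd (snd (s k))" for k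
  have sk: "s k = (m k, r k, N k)" for k by (simp add: m_def r_def N_def)
  have r: "0 \<le> r k" "r k \<le> 1"
    and eigm: "lp_norm p (\<lambda>i. (T ^^ n) (lp_unit (m k)) i - complex_of_real (r k ^ n) * lp_unit (m k) i) \<le> \<eta> k"
    and late: "N k \<le> n \<Longrightarrow> j \<le> m k \<Longrightarrow> lp_norm p ((T ^^ n) (lp_unit j)) \<le> \<eta> k"
    for k n j using s(1)[of k] by (auto simp: P_def sk)
  have Q: "m k < m (Suc k)" "N k < N (Suc k)" "1 / 2 \<le> r (Suc k) ^ N k" for k
    using s(2)[of k] by (auto simp: Q_def sk)
  have mm: "strict_mono m" and NN: "strict_mono N"
    using Q by (auto simp: strict_mono_Suc_iff)
  have injm: "inv m (m k) = k" for k
    using strict_mono_imp_inj_on[OF mm] by simp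
  define b :: "nat \<Rightarrow> real" where "b i = (if i \<in> range m then (1 / 2) ^ inv m i else 0)" for i
  have bm: "b (m k) = (1 / 2) ^ k" for k by (simp add: b_def injm)
  have "(\<lambda>k. b (m k)) sums 2"
    unfolding bm using geometric_sums[of "1 / 2 :: real"] by simp
  then have bs: "b sums 2"
    using sums_mono_reindex[OF mm, of b 2] by (simp add: b_def)
  have main: "\<exists>\<rho> \<mu> i0. 0 < \<rho> \<and> (\<forall>i. 0 \<le> \<mu> i) \<and> (\<forall>i. \<mu> i \<le> 1) \<and>
      (\<forall>i. 0 < b i \<longrightarrow> lp_norm p (\<lambda>j. (T ^^ n) (lp_unit i) j - complex_of_real (\<mu> i) * lp_unit i j) \<le> \<rho>) \<and>
      16 * \<rho> \<le> b i0 * b i0 * \<mu> i0" for n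
  proof -
    define K where "K = (LEAST k. n \<le> N k)"
    have "n \<le> N n" using NN by (rule strict_mono_imp_increasing)
    then have nK: "n \<le> N K" unfolding K_def by (rule LeastI)
    have before: "N k < n" if "k < K" for k
      using not_less_Least[of k "\<lambda>k. n \<le> N k"] that by (simp add: K_def)
    \<comment> \<open>Stages before \<open>K\<close> count as 0. Outside the range of
      \<open>m\<close> the index \<open>inv m i\<close> is arbitrary; only the bounds on
      \<open>\<mu> i\<close> matter there, since \<open>b i = 0\<close>.\<close>
    define \<mu> where "\<mu> i = (if inv m i < K then 0 else r (inv m i) ^ n)" for i
    have \<mu>: "0 \<le> \<mu> i" "\<mu> i \<le> 1" for i
      using r by (auto simp: \<mu>_def power_le_one)
    have near: "lp_norm p (\<lambda>j. (T ^^ n) (lp_unit i) j - complex_of_real (\<mu> i) * lp_unit i j) \<le> 4 * \<eta> K"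
      if "0 < b i" for i
    proof -
      have "i \<in> range m" using that by (metis b_def less_irrefl)
      then obtain k where i: "i = m k" by blast
      show ?thesis
      proof (cases "k < K")
        case True
        \<comment> \<open>All stages up to \<open>L\<close> have decayed to \<open>\<eta> L\<close>
          by time \<open>N L\<close>, and \<open>\<eta> L = 4 * \<eta> K\<close>: this is the source
          of the factor 4.\<close>
        then obtain L where K: "K = Suc L" "k \<le> L" by (cases K) auto
        then have "N L \<le> n" using before[of L] by simp
        moreover have "m k \<le> m L" using K mm by (simp add: strict_mono_less_eq)
        ultimately have "lp_norm p ((T ^^ n) (lp_unit i)) \<le> \<eta> L" using late i by blast
        then show ?thesis using True K by (simp add: \<mu>_def i injm \<eta>_def)
      next
        case False
        then have "\<eta> k \<le> \<eta> K" by (simp add: \<eta>_def power_decreasing)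
        then show ?thesis
          using eigm[where k = k and n = n] False \<eta>0[of K] by (simp add: \<mu>_def i injm)
      qed
    qed
    \<comment> \<open>Stage \<open>K + 1\<close> was chosen with \<open>N K\<close> already fixed,
      so its power is at least 1/2 up to that time; it serves as \<open>i0\<close>.\<close>
    have "1 / 2 \<le> r (Suc K) ^ N K" by (rule Q)
    also have "\<dots> \<le> r (Suc K) ^ n" using nK r by (intro power_decreasing)
    finally have "1 / 2 \<le> \<mu> (m (Suc K))" by (simp add: \<mu>_def injm)
    then have "(1 / 4) ^ Suc K * (1 / 2) \<le> (1 / 4) ^ Suc K * \<mu> (m (Suc K))"
      by (intro mult_left_mono) auto
    then have "16 * (4 * \<eta> K) \<le> b (m (Suc K)) * b (m (Suc K)) * \<mu> (m (Suc K))"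
      by (simp add: bm \<eta>_def flip: power_mult_distrib)
    then show ?thesis
      using \<mu> near \<eta>0[of K]
      by (intro exI[of _ "4 * \<eta> K"] exI[of _ \<mu>] exI[of _ "m (Suc K)"]) auto
  qed
  have "0 \<le> b i" "b i \<le> 1" for i by (auto simp: b_def power_le_one)
  moreover have "m 0 \<noteq> m 1" using Q(1)[of 0] by simp
  ultimately show ?thesis
    using that[of b "m 0" "m 1"] bs main bm[of 0] bm[of 1] by simp
qed

subsection \<open>The invariant cone and the non-supercyclic vector\<close>

text \<open>The set is an intersection of preimages of a closed half-plane under \<open>f\<close>
  composed with the powers of \<open>T\<close>, and applying \<open>T\<close> merely shifts
  \<open>n\<close>. The vector \<open>x\<close> shows that it is more than zero, and the negative of
  \<open>x\<close> that it is not everything.\<close>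

lemma cone_of_positive_functional:
  assumes p: "1 \<le> p" and T: "lp_nonexpansive p T"
    and f: "lp_functional p B f" "0 \<le> B"
    and x: "x \<in> lp_space p" "0 < Re (f x)" "\<And>n. 0 \<le> Re (f ((T ^^ n) x))"
  shows "nontrivial_invariant_closed_convex_cone p T
    {y \<in> lp_space p. \<forall>n. 0 \<le> Re (f ((T ^^ n) y))}" (is "nontrivial_invariant_closed_convex_cone p T ?C")
proof -
  define g where "g n y = f ((T ^^ n) y)" for n y
  have gf: "lp_functional p B (g n)" for n
    unfolding g_def by (rule lp_functional_comp[OF f(1) lp_nonexpansive_funpow[OF T] f(2)])
  have C: "?C = {y \<in> lp_space p. \<forall>n. 0 \<le> Re (g n y)}" by (simp add: g_def)
  have g0: "g 0 = f" by (simp add: g_def fun_eq_iff)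
  have gT: "g n (T y) = g (Suc n) y" for n y by (simp add: g_def funpow_swap1)
  have gadd: "g n (\<lambda>i. y i + z i) = g n y + g n z"
    if "y \<in> lp_space p" "z \<in> lp_space p" for n y z
    using gf[of n] that by (simp add: lp_functional_def)
  have gscale: "g n (\<lambda>i. c * y i) = c * g n y" if "y \<in> lp_space p" for n c y
    using gf[of n] that by (simp add: lp_functional_def)
  have closed: "closedin (lp_topology p) ?C"
  proof -
    have "closedin (lp_topology p) {y \<in> topspace (lp_topology p). g n y \<in> {z. 0 \<le> Re z}}" for n
      by (rule closedin_continuous_map_preimage[OF lp_functional_continuous[OF p gf f(2)]])
        (simp add: closed_halfspace_Re_ge)
    then have "closedin (lp_topology p)
        (\<Inter>n. {y \<in> topspace (lp_topology p). g n y \<in> {z. 0 \<le> Re z}})"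
      by (intro closedin_Inter) auto
    also have "(\<Inter>n. {y \<in> topspace (lp_topology p). g n y \<in> {z. 0 \<le> Re z}}) = ?C"
      unfolding C using topspace_lp_topology[OF p] by auto
    finally show ?thesis .
  qed
  have "x \<noteq> (\<lambda>_. 0)"
  proof
    assume "x = (\<lambda>_. 0)"
    then have "x = (\<lambda>i. 0 * x i)" by simp
    then show False using gscale[OF x(1), of 0 0] x(2) g0 by simp
  qed
  moreover have "x \<in> ?C" using x by simp
  ultimately have ne: "?C \<noteq> {\<lambda>_. 0}" "?C \<noteq> {}" by blast+
  have "(\<lambda>i. (-1) * x i) \<in> lp_space p" by (rule lp_space_scale[OF x(1)])
  moreover have "(\<lambda>i. (-1) * x i) \<notin> ?C"
    unfolding C using gscale[OF x(1), of 0 "-1"] x(2) g0 by (auto intro!: exI[of _ 0])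
  ultimately have proper: "?C \<noteq> lp_space p" by metis
  show ?thesis
    unfolding nontrivial_invariant_closed_convex_cone_def
  proof (intro conjI ballI allI impI)
    fix y z and u v :: real
    assume "y \<in> ?C" "z \<in> ?C" and uv: "0 \<le> u" "0 \<le> v"
    then have yz: "y \<in> lp_space p" "z \<in> lp_space p" "\<And>n. 0 \<le> Re (g n y)" "\<And>n. 0 \<le> Re (g n z)"
      by (auto simp: C)
    then show "(\<lambda>n. complex_of_real u * y n + complex_of_real v * z n) \<in> ?C"
      unfolding C using uv by (simp add: gadd gscale lp_space_scale lp_space_add[OF p])
  next
    fix t :: real assume "0 \<le> t"
    then show "(\<lambda>x n. complex_of_real t * x n) ` ?C \<subseteq> ?C"
      unfolding C by (auto simp: gscale lp_space_scale)
  next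
    show "T ` ?C \<subseteq> ?C"
      unfolding C using T by (auto simp: gT lp_nonexpansive_def)
  qed (use closed ne proper in auto)
qed

text \<open>Both discs lie in the sector where the imaginary part is at most the real part in
  absolute value, so the angle between the two numbers is at most a right angle.\<close>

lemma Re_mult_cnj_nonneg_of_near_positive:
  assumes "norm (z - complex_of_real M) \<le> M / 2" "norm (w - complex_of_real L) \<le> L / 2"
  shows "0 \<le> Re (z * cnj w)"
proof -
  have z: "\<bar>Re z - M\<bar> \<le> M / 2" "\<bar>Im z\<bar> \<le> M / 2"
    using abs_Re_le_cmod[of "z - complex_of_real M"] abs_Im_le_cmod[of "z - complex_of_real M"] assms(1)
    by auto
  have w: "\<bar>Re w - L\<bar> \<le> L / 2" "\<bar>Im w\<bar> \<le> L / 2"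
    using abs_Re_le_cmod[of "w - complex_of_real L"] abs_Im_le_cmod[of "w - complex_of_real L"] assms(2)
    by auto
  have M: "0 \<le> M / 2" "M / 2 \<le> Re z" and L: "0 \<le> L / 2" "L / 2 \<le> Re w"
    using z w by linarith+
  have "\<bar>Im z * Im w\<bar> \<le> M / 2 * (L / 2)"
    unfolding abs_mult by (rule mult_mono) (use z w M L in auto)
  also have "\<dots> \<le> Re z * Re w"
    by (rule mult_mono) (use M L in auto)
  finally show ?thesis by simp
qed

text \<open>If the orbit of \<open>x\<close> keeps the angle between \<open>f\<close> and \<open>g\<close> acute, so do all complex multiples of
  the orbit, and the limits of such multiples omit \<open>y\<close>.\<close>

lemma not_supercyclic_of_two_functionals:
  assumes p: "1 \<le> p" and T: "lp_nonexpansive p T"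
    and f: "lp_functional p B f" "0 \<le> B" and g: "lp_functional p B' g" "0 \<le> B'"
    and x: "x \<in> lp_space p" "\<And>n. 0 \<le> Re (f ((T ^^ n) x) * cnj (g ((T ^^ n) x)))"
    and y: "y \<in> lp_space p" "Re (f y * cnj (g y)) < 0"
  shows "\<not> supercyclic_vector p T x"
proof
  define h where "h z = Re (f z * cnj (g z))" for z
  have fc: "continuous_map (lp_topology p) euclidean f" and gc: "continuous_map (lp_topology p) euclidean g"
    using lp_functional_continuous[OF p f] lp_functional_continuous[OF p g] by auto
  have Re_cont: "continuous_map euclidean euclidean Re" "continuous_map euclidean euclidean Im"
    by (simp_all add: continuous_on_Re continuous_on_Im)
  have hc: "continuous_map (lp_topology p) euclidean h"
  proof -
    have "h = (\<lambda>z. (Re \<circ> f) z * (Re \<circ> g) z + (Im \<circ> f) z * (Im \<circ> g) z)"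
      by (auto simp: h_def)
    then show ?thesis
      by (simp only:) (intro continuous_map_add continuous_map_real_mult
          continuous_map_compose[OF fc] continuous_map_compose[OF gc] Re_cont)
  qed
  let ?D = "{z \<in> topspace (lp_topology p). h z \<in> {0..}}"
  have closed: "closedin (lp_topology p) ?D"
    by (rule closedin_continuous_map_preimage[OF hc]) simp
  have "(\<lambda>n. c * (T ^^ k) x n) \<in> ?D" for c k
  proof -
    have Tx: "(T ^^ k) x \<in> lp_space p"
      using lp_nonexpansive_funpow[OF T] x(1) by (simp add: lp_nonexpansive_def)
    then have "f (\<lambda>n. c * (T ^^ k) x n) * cnj (g (\<lambda>n. c * (T ^^ k) x n)) =
        (c * cnj c) * (f ((T ^^ k) x) * cnj (g ((T ^^ k) x)))"
      using f(1) g(1) by (simp add: lp_functional_def)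
    \<comment> \<open>The scalar enters only through its squared modulus, which is why all complex
      multiples of the orbit are covered.\<close>
    also have "c * cnj c = complex_of_real ((norm c)\<^sup>2)"
      by (rule complex_norm_square[symmetric])
    finally have "f (\<lambda>n. c * (T ^^ k) x n) * cnj (g (\<lambda>n. c * (T ^^ k) x n)) =
        complex_of_real ((norm c)\<^sup>2) * (f ((T ^^ k) x) * cnj (g ((T ^^ k) x)))" .
    then have "h (\<lambda>n. c * (T ^^ k) x n) = (norm c)\<^sup>2 * Re (f ((T ^^ k) x) * cnj (g ((T ^^ k) x)))"
      unfolding h_def by (simp only: times_complex.sel Re_complex_of_real Im_complex_of_real)
    then show ?thesis
      using x(2)[of k] lp_space_scale[OF Tx] by (simp del: times_complex.sel add: topspace_lp_topology[OF p])
  qed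
  then have "lp_topology p closure_of {\<lambda>n. c * (T ^^ k) x n | c k. True} \<subseteq> ?D"
    by (intro closure_of_minimal closed) blast
  moreover assume "supercyclic_vector p T x"
  ultimately have "y \<in> ?D" using y(1) unfolding supercyclic_vector_def by blast
  then show False using y(2) by (simp add: h_def)
qed

text \<open>One vector \<open>x\<close> serves both claims: the functional with weights
  \<open>b\<close> alone gives the cone, and paired with a second functional, with one weight
  raised, it excludes supercyclicity.\<close>

lemma exists_cone_and_non_supercyclic:
  assumes p: "1 \<le> p" and T: "lp_nonexpansive p T"
    and small: "\<And>m \<epsilon>. 0 < \<epsilon> \<Longrightarrow> \<exists>n. lp_norm p ((T ^^ n) (lp_unit m)) < \<epsilon>"
    and eig: "\<And>k N \<delta>. 0 < \<delta> \<Longrightarrow> \<exists>m\<ge>N.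
      lp_norm p (\<lambda>i. T (lp_unit m) i - complex_of_real (1 - 1 / (real k + 2)) * lp_unit m i) < \<delta>"
  shows "(\<exists>C. nontrivial_invariant_closed_convex_cone p T C) \<and>
    (\<exists>x\<in>lp_space p. x \<noteq> (\<lambda>_. 0) \<and> \<not> supercyclic_vector p T x)"
proof -
  obtain b :: "nat \<Rightarrow> real" and m0 m1 :: nat
    where b: "\<And>i. 0 \<le> b i" "\<And>i. b i \<le> 1" "b sums 2" and m: "m0 \<noteq> m1" "b m0 = 1" "b m1 = 1 / 2"
    and orbit: "\<And>n. \<exists>\<rho> \<mu> i0. 0 < \<rho> \<and> (\<forall>i. 0 \<le> \<mu> i) \<and> (\<forall>i. \<mu> i \<le> 1) \<and>
      (\<forall>i. 0 < b i \<longrightarrow> lp_norm p (\<lambda>j. (T ^^ n) (lp_unit i) j - complex_of_real (\<mu> i) * lp_unit i j) \<le> \<rho>) \<and>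
      16 * \<rho> \<le> b i0 * b i0 * \<mu> i0"
    by (rule exists_almost_eigenvector_sum[OF p T small eig]) (assumption | rule that)+
  define x where "x = (\<lambda>i. complex_of_real (b i))"
  have x: "x \<in> lp_space p"
    unfolding x_def using b by (intro summable_in_lp_space p) (auto simp: sums_iff)
  have near: "\<exists>M>0. norm (lp_weighted b' ((T ^^ n) x) - complex_of_real M) \<le> M / 2"
    if b': "\<And>i. b i \<le> b' i" "summable b'" "suminf b' \<le> 4" for b' n
  proof -
    obtain \<rho> \<mu> i0 where o: "0 < \<rho>" "\<And>i. 0 \<le> \<mu> i" "\<And>i. \<mu> i \<le> 1"
      "\<And>i. 0 < b i \<Longrightarrow> lp_norm p (\<lambda>j. (T ^^ n) (lp_unit i) j - complex_of_real (\<mu> i) * lp_unit i j) \<le> \<rho>"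
      "16 * \<rho> \<le> b i0 * b i0 * \<mu> i0"
      using orbit[of n] by blast
    have "summable b" "suminf b \<le> 2" using b(3) by (auto simp: sums_iff)
    from lp_weighted_orbit_near_positive[OF p lp_nonexpansive_funpow[OF T] b(1,2) this b' o(2,3,1,4,5)]
    show ?thesis unfolding x_def by assumption
  qed
  \<comment> \<open>Raising the weight at \<open>m0\<close> makes the second functional independent
    of the first, while \<open>b i \<le> b' i\<close> holds and the total 3 stays within the 4
    allowed by \<open>near\<close>.\<close>
  define b' where "b' i = b i + (if i = m0 then 1 else 0)" for i
  have b's: "b' sums 3"
    unfolding b'_def using sums_add[OF b(3) sums_single[of m0 "\<lambda>_. 1"]] by simp
  define f g where "f = lp_weighted b" and "g = lp_weighted b'"
  have near_f: "\<exists>M>0. norm (f ((T ^^ n) x) - complex_of_real M) \<le> M / 2"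
    and near_g: "\<exists>M>0. norm (g ((T ^^ n) x) - complex_of_real M) \<le> M / 2" for n
    unfolding f_def g_def by (rule near; use b(3) b's in \<open>simp add: sums_iff b'_def\<close>)+
  have F: "lp_functional p 2 f"
    using lp_weighted_functional[OF p, of b] b(1,3) by (simp add: f_def sums_iff)
  have G: "lp_functional p 3 g"
    using lp_weighted_functional[OF p, of b'] b(1) b's by (simp add: g_def sums_iff b'_def)
  have Re_f: "0 < Re (f ((T ^^ n) x))" for n
  proof -
    obtain M where M: "0 < M" "norm (f ((T ^^ n) x) - complex_of_real M) \<le> M / 2"
      using near_f by blast
    have "\<bar>Re (f ((T ^^ n) x)) - M\<bar> \<le> M / 2"
      using abs_Re_le_cmod[of "f ((T ^^ n) x) - complex_of_real M"] M(2) by simp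
    then show ?thesis using M(1) by linarith
  qed
  have "nontrivial_invariant_closed_convex_cone p T {y \<in> lp_space p. \<forall>n. 0 \<le> Re (f ((T ^^ n) y))}"
    using Re_f[of 0] Re_f by (intro cone_of_positive_functional[OF p T F _ x]) (auto intro: less_imp_le)
  moreover have "\<not> supercyclic_vector p T x"
  proof (rule not_supercyclic_of_two_functionals[OF p T F _ G _ x])
    show "0 \<le> Re (f ((T ^^ n) x) * cnj (g ((T ^^ n) x)))" for n
      using near_f[of n] near_g[of n] by (blast intro: Re_mult_cnj_nonneg_of_near_positive)
    \<comment> \<open>On \<open>m0\<close> and \<open>m1\<close> the weights are 1 and 1/2 for
      \<open>f\<close>, and 2 and 1/2 for \<open>g\<close>; the coefficients -2 and 6 give
      \<open>f y = 1\<close> and \<open>g y = -1\<close>.\<close>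
    define y where "y = (\<lambda>i. (-2) * lp_unit m0 i + 6 * lp_unit m1 i)"
    show "y \<in> lp_space p"
      unfolding y_def by (intro lp_space_add lp_space_scale lp_unit_in p)
    have val: "h y = -2 * h (lp_unit m0) + 6 * h (lp_unit m1)" if "lp_functional p B h" for h B
    proof -
      note u = lp_unit_in[OF p]
      have add: "h (\<lambda>i. u i + v i) = h u + h v" if "u \<in> lp_space p" "v \<in> lp_space p" for u v
        using \<open>lp_functional p B h\<close> that unfolding lp_functional_def by blast
      have "h y = h (\<lambda>i. (-2) * lp_unit m0 i) + h (\<lambda>i. 6 * lp_unit m1 i)"
        unfolding y_def by (intro add lp_space_scale u)
      also have "\<dots> = -2 * h (lp_unit m0) + 6 * h (lp_unit m1)"
        using that u unfolding lp_functional_def by metis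
      finally show ?thesis .
    qed
    have "f y = 1" "g y = -1"
      using val[OF F] val[OF G] m by (simp_all add: f_def g_def lp_weighted_unit b'_def)
    then show "Re (f y * cnj (g y)) < 0" by simp
  qed auto
  moreover have "x m0 \<noteq> 0" using m by (simp add: x_def)
  then have "x \<noteq> (\<lambda>_. 0)" by metis
  ultimately show ?thesis using x by blast
qed

section \<open>Passage to a countable intersection of dense open sets\<close>

theorem proposition5p26:
  fixes p :: real
  assumes "1 < p"
  shows "comeager_in (lp_SOT p)
    {T \<in> lp_contractions p.
       (\<exists>C. nontrivial_invariant_closed_convex_cone p T C) \<and>
       (\<exists>x\<in>lp_space p. x \<noteq> (\<lambda>_. 0) \<and> \<not> supercyclic_vector p T x)}"
    (is "comeager_in _ ?A")
proof -
  have p: "1 \<le> p" using assms by simp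
  \<comment> \<open>Tolerances of the form \<open>inverse (real (Suc j))\<close> and eigenvalues
    from the sequence \<open>1 - 1 / (real k + 2)\<close> keep the family of open sets
    countable.\<close>
  define U where "U = (\<lambda>(m, j). {T \<in> lp_contractions p.
    \<exists>n. lp_norm p ((T ^^ n) (lp_unit m)) < inverse (real (Suc j))})"
  define V where "V = (\<lambda>(k :: nat, N, j). {T \<in> lp_contractions p. \<exists>m\<ge>N.
    lp_norm p (\<lambda>i. T (lp_unit m) i - complex_of_real (1 - 1 / (real k + 2)) * lp_unit m i)
      < inverse (real (Suc j))})"
  have r: "0 \<le> 1 - 1 / (real k + 2)" "1 - 1 / (real k + 2) \<le> 1" for k
    by (auto simp: field_simps)
  have pos: "0 < inverse (real (Suc j))" for j by simp
  let ?W = "range U \<union> range V"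
  show ?thesis
  proof (rule comeager_in_countable_Inter[of ?W "lp_SOT p" id])
    show "countable ?W" by simp
    show "openin (lp_SOT p) (id W)" "lp_SOT p closure_of (id W) = topspace (lp_SOT p)"
      if "W \<in> ?W" for W
      using that generic_small_power[OF p lp_unit_in[OF p] pos]
        generic_almost_eigenvector[OF p r pos]
      by (auto simp: U_def V_def)
    show "?A \<subseteq> topspace (lp_SOT p)"
      by (auto simp: topspace_lp_SOT[OF p])
    show "topspace (lp_SOT p) \<inter> (\<Inter>W\<in>?W. id W) \<subseteq> ?A"
    proof
      fix T assume "T \<in> topspace (lp_SOT p) \<inter> (\<Inter>W\<in>?W. id W)"
      then have T: "T \<in> lp_contractions p" and TU: "\<And>m j. T \<in> U (m, j)" and TV: "\<And>k N j. T \<in> V (k, N, j)"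
        by (auto simp: topspace_lp_SOT[OF p])
      have "\<exists>n. lp_norm p ((T ^^ n) (lp_unit m)) < \<epsilon>" if \<epsilon>: "0 < \<epsilon>" for m \<epsilon>
      proof -
        obtain j where "inverse (real (Suc j)) < \<epsilon>" using reals_Archimedean[OF \<epsilon>] by blast
        then show ?thesis using TU[of m j] unfolding U_def by (auto intro: less_trans)
      qed
      moreover have "\<exists>m\<ge>N. lp_norm p (\<lambda>i. T (lp_unit m) i
          - complex_of_real (1 - 1 / (real k + 2)) * lp_unit m i) < \<delta>" if \<delta>: "0 < \<delta>" for k N \<delta>
      proof -
        obtain j where "inverse (real (Suc j)) < \<delta>" using reals_Archimedean[OF \<delta>] by blast
        then show ?thesis using TV[of k N j] unfolding V_def by (auto intro: less_trans)
      qed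
      ultimately show "T \<in> ?A"
        using exists_cone_and_non_supercyclic[OF p lp_contractions_nonexpansive[OF p T]] T by blast
    qed
  qed
qed

end
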